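(* Let $\tau>0$ and $\sigma\ge 0$ satisfy $$\sigma^2<2,\qquad \tau<1-\sqrt{\sigma^2-\frac{\sigma^4}{4}},$$ or, equivalently, $$\tau<1,\qquad \sigma<\sqrt{2-\tau}-\sqrt{\tau}.$$ Then for every continuous deterministic initial datum $w_0:[-\tau,0]\to\mathbb{R}$, the solution $w=w(t)$ of the stochastic delay differential equation $$\mathrm{d}w(t)=-w(t-\tau)\,\mathrm{d}t+\sigma\, w(t-\tau)\,\mathrm{d}B_t\quad (t>0),\qquad w(s)=w_0(s)\ \text{ for } s\in[-\tau,0],$$ satisfies $$\lim_{t\to\infty}\mathbb{E}[w(t)^2]=0.$$
   Context: $B_t$ is a standard one-dimensional Brownian motion (Wiener process), and the equation is understood in the It\^{o} sense. The solution is the unique global adapted process $w$ on $[-\tau,\infty)$ satisfying the equation and the initial condition, with $\mathbb{E}\left[\int_{-\tau}^T|w(t)|^2\,\mathrm{d}t\right]<\infty$ for all $T<\infty$. *)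

theory Defs
  imports "HOL-Probability.Probability"
begin

text \<open>
  Only the times \<open>t \<ge> 0\<close> of the filtration matter for the Brownian motion; a filtration that is
  given on \<open>[0,\<infinity>)\<close> is extended by \<open>F t = F 0\<close> for \<open>t < 0\<close>. No completeness or right-continuity of
  the filtration is assumed.
\<close>

locale standard_brownian_motion = prob_space M + filtration "space M" F
  for M :: "'a measure" and F :: "real \<Rightarrow> 'a measure" +
  fixes B :: "real \<Rightarrow> 'a \<Rightarrow> real"
  assumes subalgebra_F: "\<And>t. subalgebra M (F t)"
    and adapted: "\<And>t. 0 \<le> t \<Longrightarrow> B t \<in> borel_measurable (F t)"
    and starts_at_0: "AE \<omega> in M. B 0 \<omega> = 0"
    and continuous_paths: "AE \<omega> in M. continuous_on {0..} (\<lambda>t. B t \<omega>)"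
    and normal_increments: "\<And>s t. 0 \<le> s \<Longrightarrow> s < t \<Longrightarrow>
      distributed M lborel (\<lambda>\<omega>. B t \<omega> - B s \<omega>) (normal_density 0 (sqrt (t - s)))"
    and indep_increments: "\<And>s t. 0 \<le> s \<Longrightarrow> s < t \<Longrightarrow>
      indep_set (sets (F s)) (sets (vimage_algebra (space M) (\<lambda>\<omega>. B t \<omega> - B s \<omega>) borel))"

record 'a simple_process =
  steps :: nat
  grid :: "nat \<Rightarrow> real"
  coeff :: "nat \<Rightarrow> 'a \<Rightarrow> real"

definition simple_process_on ::
  "'a measure \<Rightarrow> (real \<Rightarrow> 'a measure) \<Rightarrow> real \<Rightarrow> 'a simple_process \<Rightarrow> bool" where
  "simple_process_on M F T \<phi> \<longleftrightarrow>
     grid \<phi> 0 = 0 \<and> grid \<phi> (steps \<phi>) = T \<and>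
     (\<forall>i<steps \<phi>. grid \<phi> i < grid \<phi> (Suc i) \<and>
        coeff \<phi> i \<in> borel_measurable (F (grid \<phi> i)) \<and>
        (\<exists>C. \<forall>\<omega>\<in>space M. \<bar>coeff \<phi> i \<omega>\<bar> \<le> C))"

definition simple_value :: "'a simple_process \<Rightarrow> real \<Rightarrow> 'a \<Rightarrow> real" where
  "simple_value \<phi> s \<omega> =
     (\<Sum>i<steps \<phi>. coeff \<phi> i \<omega> * indicator {grid \<phi> i<..grid \<phi> (Suc i)} s)"

definition simple_ito_integral ::
  "(real \<Rightarrow> 'a \<Rightarrow> real) \<Rightarrow> 'a simple_process \<Rightarrow> 'a \<Rightarrow> real" where
  "simple_ito_integral B \<phi> \<omega> =
     (\<Sum>i<steps \<phi>. coeff \<phi> i \<omega> * (B (grid \<phi> (Suc i)) \<omega> - B (grid \<phi> i) \<omega>))"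

definition ito_integrand ::
  "'a measure \<Rightarrow> (real \<Rightarrow> 'a measure) \<Rightarrow> real \<Rightarrow> (real \<Rightarrow> 'a \<Rightarrow> real) \<Rightarrow> bool" where
  "ito_integrand M F T f \<longleftrightarrow>
     (\<lambda>(s, \<omega>). f s \<omega>) \<in> borel_measurable (restrict_space borel {0..T} \<Otimes>\<^sub>M M) \<and>
     (\<forall>s\<in>{0..T}. f s \<in> borel_measurable (F s)) \<and>
     (\<integral>\<^sup>+\<omega>. (\<integral>\<^sup>+s\<in>{0..T}. ennreal ((f s \<omega>)\<^sup>2) \<partial>lborel) \<partial>M) < \<infinity>"

text \<open>
  \<open>has_ito_integral M F B T f I\<close>: the random variable \<open>I\<close> is a version of \<open>\<integral>\<^sub>0\<^sup>T f dB\<close>, i.e. the limit in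
  mean square of the elementary integrals of simple processes that approximate \<open>f\<close> in
  \<open>L\<^sup>2([0,T] \<times> \<Omega>)\<close>. By the Ito isometry \<open>I\<close> is unique up to null sets and does not depend on the
  approximating sequence.
\<close>

definition has_ito_integral ::
  "'a measure \<Rightarrow> (real \<Rightarrow> 'a measure) \<Rightarrow> (real \<Rightarrow> 'a \<Rightarrow> real) \<Rightarrow> real \<Rightarrow>
    (real \<Rightarrow> 'a \<Rightarrow> real) \<Rightarrow> ('a \<Rightarrow> real) \<Rightarrow> bool" where
  "has_ito_integral M F B T f I \<longleftrightarrow>
     ito_integrand M F T f \<and> I \<in> borel_measurable M \<and>
     (\<exists>\<phi> :: nat \<Rightarrow> 'a simple_process.
        (\<forall>n. simple_process_on M F T (\<phi> n)) \<and>
        (\<lambda>n. \<integral>\<^sup>+\<omega>. (\<integral>\<^sup>+s\<in>{0..T}. ennreal ((simple_value (\<phi> n) s \<omega> - f s \<omega>)\<^sup>2) \<partial>lborel) \<partial>M)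
          \<longlonglongrightarrow> 0 \<and>
        (\<lambda>n. \<integral>\<^sup>+\<omega>. ennreal ((simple_ito_integral B (\<phi> n) \<omega> - I \<omega>)\<^sup>2) \<partial>M) \<longlonglongrightarrow> 0)"

text \<open>
  The equation is read in integrated form, almost surely for each fixed \<open>t \<ge> 0\<close>, so a solution is
  determined up to modification and path continuity is not required (a continuous solution is in
  particular a solution in this sense).
\<close>

definition sdde_solution ::
  "'a measure \<Rightarrow> (real \<Rightarrow> 'a measure) \<Rightarrow> (real \<Rightarrow> 'a \<Rightarrow> real) \<Rightarrow> real \<Rightarrow> real \<Rightarrow>
    (real \<Rightarrow> real) \<Rightarrow> (real \<Rightarrow> 'a \<Rightarrow> real) \<Rightarrow> bool" where
  "sdde_solution M F B \<tau> \<sigma> w0 w \<longleftrightarrow>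
     (\<lambda>(t, \<omega>). w t \<omega>) \<in> borel_measurable (restrict_space borel {-\<tau>..} \<Otimes>\<^sub>M M) \<and>
     (\<forall>t\<ge>-\<tau>. w t \<in> borel_measurable (F t)) \<and>
     (\<forall>T. (\<integral>\<^sup>+\<omega>. (\<integral>\<^sup>+t\<in>{-\<tau>..T}. ennreal ((w t \<omega>)\<^sup>2) \<partial>lborel) \<partial>M) < \<infinity>) \<and>
     (\<forall>s\<in>{-\<tau>..0}. AE \<omega> in M. w s \<omega> = w0 s) \<and>
     (\<forall>t\<ge>0. \<exists>I. has_ito_integral M F B t (\<lambda>s. w (s - \<tau>)) I \<and>
        (AE \<omega> in M. w t \<omega> = w0 0 - (LBINT s:{0..t}. w (s - \<tau>) \<omega>) + \<sigma> * I \<omega>))"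

end

theory Submission
  imports Defs
begin

text \<open>
  The stated condition forces \<open>2\<tau> + \<sigma>\<^sup>2 < 2\<close>, which is what drives the decay. Put
  \<open>z(t) = w(t) - \<integral>\<^bsub>t-\<tau>\<^esub>\<^bsup>t\<^esup> w\<close>, so that \<open>dz = -w dt + \<sigma> w(t - \<tau>) dB\<close>: the drift is no longer delayed.
  Ito's formula is avoided by expanding the square of \<open>z(t) = c - A(t) + \<sigma> I(t)\<close>, where \<open>A\<close> is the
  time integral of \<open>w\<close> from \<open>-\<tau>\<close> and \<open>I\<close> the stochastic integral: by Fubini
  \<open>E A(t)\<^sup>2 = 2 \<integral> E[w(r) A(r)] dr\<close>, and by Fubini and the martingale property
  \<open>E[A(t) I(t)] = \<integral> E[w(r) I(r)] dr\<close>, so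
  \<open>E z(t)\<^sup>2 = C + \<sigma>\<^sup>2 \<integral> E w(r - \<tau>)\<^sup>2 dr - 2 \<integral> E[w(r) z(r)] dr\<close>.
  Estimating \<open>E[w z]\<close> by the arithmetic-geometric mean bounds \<open>(2 - 2\<tau> - \<sigma>\<^sup>2) \<integral> E w(r)\<^sup>2 dr\<close> uniformly in \<open>t\<close>.
  Finally \<open>E w(t)\<^sup>2\<close> is at most twice \<open>E w(s)\<^sup>2\<close> plus a multiple of \<open>\<integral> E w\<^sup>2\<close> over \<open>[s - \<tau>, t - \<tau>]\<close>;
  averaging over \<open>s \<in> [t - 1, t]\<close> and using integrability gives the limit.
\<close>

subsection \<open>Square integrable functions\<close>

text \<open>The equation holds only almost surely at each fixed time, with versions of the
  stochastic integral that are unrelated from one time to the next. The argument therefore stays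
  with second moments and covariances at fixed times, and the differentiation that Ito's formula
  would perform becomes an interchange of integrals over a triangle. From the identity for
  \<open>E z^2\<close> only the sign of the left side is extracted: dissipation cannot exceed the
  noise input by more than a constant. The threshold can then be read off. Twice
  \<open>E[w z]\<close> supplies \<open>2 E w^2\<close>; the memory term is a covariance over a
  window of length \<tau>, and each half of its mean inequality costs \<tau> times the energy after
  integration in time; the isometry costs \<sigma>^2 times the energy. A finite integral of
  \<open>E w^2\<close> does not by itself force decay, since ever narrower peaks could remain. The
  increment bound excludes them: growth within unit time is paid for by energy.\<close>

definition square_integrable :: "'a measure \<Rightarrow> ('a \<Rightarrow> real) \<Rightarrow> bool" where
  "square_integrable N f \<longleftrightarrow> f \<in> borel_measurable N \<and> integrable N (\<lambda>x. (f x)\<^sup>2)"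

text \<open>The nonnegative integral keeps this meaningful before the limit is known to be square
  integrable. A Bochner integral would take the value 0 on a non-integrable square and so report
  convergence falsely.\<close>

definition l2_tendsto :: "'a measure \<Rightarrow> (nat \<Rightarrow> 'a \<Rightarrow> real) \<Rightarrow> ('a \<Rightarrow> real) \<Rightarrow> bool" where
  "l2_tendsto N f g \<longleftrightarrow> (\<lambda>n. \<integral>\<^sup>+x. ennreal ((f n x - g x)\<^sup>2) \<partial>N) \<longlonglongrightarrow> 0"

lemma square_integrable_measurable: "square_integrable N f \<Longrightarrow> f \<in> borel_measurable N"
  by (simp add: square_integrable_def)

lemma square_integrableD: "square_integrable N f \<Longrightarrow> integrable N (\<lambda>x. (f x)\<^sup>2)"
  by (simp add: square_integrable_def)

lemma square_integrable_mult:
  assumes "square_integrable N f" "square_integrable N g"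
  shows "integrable N (\<lambda>x. f x * g x)"
proof -
  have [measurable]: "f \<in> borel_measurable N" "g \<in> borel_measurable N"
    using assms by (auto simp: square_integrable_def)
  have bound: "\<bar>a * b\<bar> \<le> \<bar>a\<^sup>2 + b\<^sup>2\<bar>" for a b :: real
  proof -
    have "0 \<le> (\<bar>a\<bar> - \<bar>b\<bar>)\<^sup>2" "0 \<le> \<bar>a\<bar> * \<bar>b\<bar>" by simp_all
    then show ?thesis unfolding power2_diff abs_mult power2_abs by linarith
  qed
  show ?thesis
  proof (rule Bochner_Integration.integrable_bound)
    show "integrable N (\<lambda>x. (f x)\<^sup>2 + (g x)\<^sup>2)"
      using assms by (intro Bochner_Integration.integrable_add) (auto simp: square_integrable_def)
    show "AE x in N. norm (f x * g x) \<le> norm ((f x)\<^sup>2 + (g x)\<^sup>2)"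
      unfolding real_norm_def by (intro AE_I2 bound)
  qed measurable
qed

lemma square_integrable_cmult:
  "square_integrable N f \<Longrightarrow> square_integrable N (\<lambda>x. c * f x)"
  by (auto simp: square_integrable_def power_mult_distrib)

lemma square_integrable_zero [intro, simp]: "square_integrable N (\<lambda>x. 0)"
  by (simp add: square_integrable_def)

lemma square_integrable_add:
  assumes "square_integrable N f" "square_integrable N g"
  shows "square_integrable N (\<lambda>x. f x + g x)"
  using assms square_integrable_mult[OF assms]
  by (auto simp: square_integrable_def power2_sum mult.assoc)

lemma square_integrable_diff:
  assumes "square_integrable N f" "square_integrable N g"
  shows "square_integrable N (\<lambda>x. f x - g x)"
  using square_integrable_add[OF assms(1) square_integrable_cmult[OF assms(2), of "-1"]] by simp

lemma square_integrable_iff_nn: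
  "square_integrable N f \<longleftrightarrow>
    f \<in> borel_measurable N \<and> (\<integral>\<^sup>+x. ennreal ((f x)\<^sup>2) \<partial>N) < \<infinity>"
  by (auto simp: square_integrable_def integrable_iff_bounded)

lemma square_integrable_cong_AE:
  assumes "square_integrable N f" "g \<in> borel_measurable N" "AE x in N. g x = f x"
  shows "square_integrable N g"
proof -
  have "(\<integral>\<^sup>+x. ennreal ((g x)\<^sup>2) \<partial>N) = (\<integral>\<^sup>+x. ennreal ((f x)\<^sup>2) \<partial>N)"
    using assms(3) by (intro nn_integral_cong_AE) auto
  with assms show ?thesis by (simp add: square_integrable_iff_nn)
qed

lemma square_integrable_cong:
  assumes "\<And>x. x \<in> space N \<Longrightarrow> f x = g x"
  shows "square_integrable N f \<longleftrightarrow> square_integrable N g"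
proof -
  have "f \<in> borel_measurable N \<longleftrightarrow> g \<in> borel_measurable N"
    by (rule measurable_cong) (rule assms)
  moreover have "integrable N (\<lambda>x. (f x)\<^sup>2) \<longleftrightarrow> integrable N (\<lambda>x. (g x)\<^sup>2)"
    by (rule Bochner_Integration.integrable_cong) (simp_all add: assms)
  ultimately show ?thesis by (simp add: square_integrable_def)
qed

lemma square_integrable_bounded_mult:
  assumes f: "square_integrable N f" and c: "c \<in> borel_measurable N"
    "\<And>x. x \<in> space N \<Longrightarrow> \<bar>c x\<bar> \<le> C"
  shows "square_integrable N (\<lambda>x. c x * f x)"
  unfolding square_integrable_def
proof
  note [measurable] = square_integrable_measurable[OF f] c(1)
  show "(\<lambda>x. c x * f x) \<in> borel_measurable N" by measurable
  show "integrable N (\<lambda>x. (c x * f x)\<^sup>2)"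
  proof (rule Bochner_Integration.integrable_bound)
    show "integrable N (\<lambda>x. C\<^sup>2 * (f x)\<^sup>2)" using f by (simp add: square_integrable_def)
    show "AE x in N. norm ((c x * f x)\<^sup>2) \<le> norm (C\<^sup>2 * (f x)\<^sup>2)"
    proof (rule AE_I2)
      fix x assume "x \<in> space N"
      then have "(c x)\<^sup>2 \<le> C\<^sup>2" using power_mono[OF c(2)[of x] abs_ge_zero, of 2] by simp
      then show "norm ((c x * f x)\<^sup>2) \<le> norm (C\<^sup>2 * (f x)\<^sup>2)"
        unfolding real_norm_def power_mult_distrib abs_mult abs_power2
        by (rule mult_right_mono) simp
    qed
  qed measurable
qed

lemma (in finite_measure) square_integrable_const [intro, simp]: "square_integrable M (\<lambda>x. c)"
  by (simp add: square_integrable_def)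

lemma (in finite_measure) square_integrable_imp_integrable:
  "square_integrable M f \<Longrightarrow> integrable M f"
  using square_integrable_mult[of M f "\<lambda>_. 1"] by simp

lemma integral_square_diff:
  assumes "square_integrable N f" "square_integrable N g"
  shows "(\<integral>x. (f x - g x)\<^sup>2 \<partial>N) =
    (\<integral>x. (f x)\<^sup>2 \<partial>N) - 2 * (\<integral>x. f x * g x \<partial>N) + (\<integral>x. (g x)\<^sup>2 \<partial>N)"
proof -
  note I = square_integrableD[OF assms(1)] square_integrableD[OF assms(2)]
    square_integrable_mult[OF assms]
  have "(\<integral>x. (f x - g x)\<^sup>2 \<partial>N) = (\<integral>x. ((f x)\<^sup>2 + (g x)\<^sup>2) - 2 * (f x * g x) \<partial>N)"
    by (simp add: power2_diff mult.assoc)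
  also have "\<dots> = ((\<integral>x. (f x)\<^sup>2 \<partial>N) + (\<integral>x. (g x)\<^sup>2 \<partial>N)) - 2 * (\<integral>x. f x * g x \<partial>N)"
    using I by simp
  finally show ?thesis by simp
qed

lemma Cauchy_Schwarz_integral:
  assumes f: "square_integrable N f" and g: "square_integrable N g"
  shows "(\<integral>x. f x * g x \<partial>N)\<^sup>2 \<le> (\<integral>x. (f x)\<^sup>2 \<partial>N) * (\<integral>x. (g x)\<^sup>2 \<partial>N)"
proof -
  define a b c where "a = (\<integral>x. (f x)\<^sup>2 \<partial>N)" and "b = (\<integral>x. f x * g x \<partial>N)"
    and "c = (\<integral>x. (g x)\<^sup>2 \<partial>N)"
  have q: "0 \<le> a - 2 * (t * b) + t\<^sup>2 * c" for t
  proof -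
    have "0 \<le> (\<integral>x. (f x - t * g x)\<^sup>2 \<partial>N)" by simp
    also have "\<dots> = a - 2 * (t * b) + t\<^sup>2 * c"
      unfolding integral_square_diff[OF f square_integrable_cmult[OF g]]
      by (simp add: a_def b_def c_def power_mult_distrib mult.left_commute)
    finally show ?thesis .
  qed
  have c0: "0 \<le> c" by (simp add: c_def)
  have "b\<^sup>2 \<le> a * c"
  proof (cases "c = 0")
    case True
    have "b = 0"
    proof (rule ccontr)
      assume "b \<noteq> 0"
      \<comment> \<open>With \<open>c = 0\<close> the quadratic is affine in \<open>t\<close>, and
        this choice gives it the value -1.\<close>
      then show False using q[of "(a + 1) / (2 * b)"] True by (simp add: field_simps)
    qed
    with True show ?thesis by simp
  next
    case False
    then have "c > 0" using c0 by simp
    have "b / c * b = b\<^sup>2 / c" "(b / c)\<^sup>2 * c = b\<^sup>2 / c"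
      using \<open>c > 0\<close> by (simp_all add: power2_eq_square)
    \<comment> \<open>The quadratic attains its minimum at \<open>t = b / c\<close>.\<close>
    then have "b\<^sup>2 / c \<le> a" using q[of "b / c"] by linarith
    then show ?thesis using \<open>c > 0\<close> by (simp add: field_simps)
  qed
  then show ?thesis by (simp add: a_def b_def c_def)
qed

section \<open>Convergence in mean square\<close>

context
  fixes N :: "'a measure" and f :: "nat \<Rightarrow> 'a \<Rightarrow> real" and h :: "'a \<Rightarrow> real"
  assumes f: "\<And>n. square_integrable N (f n)" and h: "h \<in> borel_measurable N"
    and lim: "l2_tendsto N f h"
begin

text \<open>A single index with error below 1 suffices: \<open>h\<close> then differs from
  \<open>f n\<close> by a square integrable function.\<close>

lemma square_integrable_l2_limit: "square_integrable N h"
proof -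
  have [measurable]: "f n \<in> borel_measurable N" "h \<in> borel_measurable N" for n
    using f h by (auto simp: square_integrable_def)
  have "\<forall>\<^sub>F n in sequentially. (\<integral>\<^sup>+x. ennreal ((f n x - h x)\<^sup>2) \<partial>N) < 1"
    using lim unfolding l2_tendsto_def by (rule order_tendstoD) simp
  then obtain n where "(\<integral>\<^sup>+x. ennreal ((f n x - h x)\<^sup>2) \<partial>N) < 1"
    by (meson eventually_happens sequentially_bot)
  then have "square_integrable N (\<lambda>x. f n x - h x)"
    unfolding square_integrable_iff_nn
    by (auto intro: less_trans)
  from square_integrable_diff[OF f[of n] this] show ?thesis by simp
qed

lemma l2_tendsto_integral_square_diff: "(\<lambda>n. \<integral>x. (f n x - h x)\<^sup>2 \<partial>N) \<longlonglongrightarrow> 0"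
proof -
  have "square_integrable N (\<lambda>x. f n x - h x)" for n
    by (rule square_integrable_diff[OF f square_integrable_l2_limit])
  then have "(\<integral>\<^sup>+x. ennreal ((f n x - h x)\<^sup>2) \<partial>N) = ennreal (\<integral>x. (f n x - h x)\<^sup>2 \<partial>N)" for n
    by (intro nn_integral_eq_integral) (auto simp: square_integrable_def)
  with lim show ?thesis
    unfolding l2_tendsto_def by (simp add: tendsto_ennreal_iff flip: ennreal_0)
qed

lemma l2_tendsto_integral_mult:
  assumes g: "square_integrable N g"
  shows "(\<lambda>n. \<integral>x. f n x * g x \<partial>N) \<longlonglongrightarrow> (\<integral>x. h x * g x \<partial>N)"
proof -
  note hh = square_integrable_l2_limit
  have d: "square_integrable N (\<lambda>x. f n x - h x)" for n by (rule square_integrable_diff[OF f hh])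
  have "(\<lambda>n. (\<integral>x. (f n x - h x)\<^sup>2 \<partial>N) * (\<integral>x. (g x)\<^sup>2 \<partial>N)) \<longlonglongrightarrow> 0"
    by (rule tendsto_mult_left_zero[OF l2_tendsto_integral_square_diff])
  moreover have "\<forall>\<^sub>F n in sequentially. norm ((\<integral>x. (f n x - h x) * g x \<partial>N)\<^sup>2) \<le>
      (\<integral>x. (f n x - h x)\<^sup>2 \<partial>N) * (\<integral>x. (g x)\<^sup>2 \<partial>N)"
    using Cauchy_Schwarz_integral[OF d g] by (intro always_eventually allI) simp
  ultimately have "(\<lambda>n. (\<integral>x. (f n x - h x) * g x \<partial>N)\<^sup>2) \<longlonglongrightarrow> 0"
    by (rule Lim_null_comparison[rotated])
  then have "(\<lambda>n. \<integral>x. (f n x - h x) * g x \<partial>N) \<longlonglongrightarrow> 0"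
    by (simp add: power_tendsto_0_iff)
  moreover have "(\<integral>x. (f n x - h x) * g x \<partial>N) = (\<integral>x. f n x * g x \<partial>N) - (\<integral>x. h x * g x \<partial>N)" for n
    using square_integrable_mult[OF f g] square_integrable_mult[OF hh g]
    by (simp add: left_diff_distrib)
  ultimately show ?thesis by (simp add: LIM_zero_iff)
qed

text \<open>Expanding \<open>(f n - h)^2\<close> reduces this to the convergence of the inner
  products with \<open>h\<close> itself.\<close>

lemma l2_tendsto_integral_square: "(\<lambda>n. \<integral>x. (f n x)\<^sup>2 \<partial>N) \<longlonglongrightarrow> (\<integral>x. (h x)\<^sup>2 \<partial>N)"
proof -
  note hh = square_integrable_l2_limit
  have "(\<integral>x. (f n x)\<^sup>2 \<partial>N) = (\<integral>x. (f n x - h x)\<^sup>2 \<partial>N) + 2 * (\<integral>x. f n x * h x \<partial>N) - (\<integral>x. (h x)\<^sup>2 \<partial>N)" for n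
    using integral_square_diff[OF f hh, of n] by simp
  moreover have "(\<lambda>n. (\<integral>x. (f n x - h x)\<^sup>2 \<partial>N) + 2 * (\<integral>x. f n x * h x \<partial>N) - (\<integral>x. (h x)\<^sup>2 \<partial>N))
      \<longlonglongrightarrow> 0 + 2 * (\<integral>x. h x * h x \<partial>N) - (\<integral>x. (h x)\<^sup>2 \<partial>N)"
    by (intro tendsto_intros l2_tendsto_integral_square_diff l2_tendsto_integral_mult hh)
  ultimately show ?thesis by (simp add: power2_eq_square)
qed

end

lemma l2_tendsto_diff:
  assumes "\<And>n. f n \<in> borel_measurable N" "\<And>n. g n \<in> borel_measurable N"
    "f0 \<in> borel_measurable N" "g0 \<in> borel_measurable N"
    and lim: "l2_tendsto N f f0" "l2_tendsto N g g0"
  shows "l2_tendsto N (\<lambda>n x. f n x - g n x) (\<lambda>x. f0 x - g0 x)"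
proof -
  note [measurable] = assms(1-4)
  have "(\<integral>\<^sup>+x. ennreal (((f n x - g n x) - (f0 x - g0 x))\<^sup>2) \<partial>N) \<le>
      2 * (\<integral>\<^sup>+x. ennreal ((f n x - f0 x)\<^sup>2) \<partial>N) + 2 * (\<integral>\<^sup>+x. ennreal ((g n x - g0 x)\<^sup>2) \<partial>N)" for n
  proof -
    have *: "((a - b) - (c - d))\<^sup>2 \<le> 2 * (a - c)\<^sup>2 + 2 * (b - d)\<^sup>2" for a b c d :: real
      using sum_squares_bound[of "a - c" "-(b - d)"] by (simp add: power2_eq_square algebra_simps)
    have "(\<integral>\<^sup>+x. ennreal (((f n x - g n x) - (f0 x - g0 x))\<^sup>2) \<partial>N) \<le>
       (\<integral>\<^sup>+x. 2 * ennreal ((f n x - f0 x)\<^sup>2) + 2 * ennreal ((g n x - g0 x)\<^sup>2) \<partial>N)"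
    proof (rule nn_integral_mono)
      fix x
      have "2 * ennreal ((f n x - f0 x)\<^sup>2) + 2 * ennreal ((g n x - g0 x)\<^sup>2) =
          ennreal (2 * (f n x - f0 x)\<^sup>2 + 2 * (g n x - g0 x)\<^sup>2)"
        by (simp add: ennreal_mult)
      then show "ennreal (((f n x - g n x) - (f0 x - g0 x))\<^sup>2) \<le>
          2 * ennreal ((f n x - f0 x)\<^sup>2) + 2 * ennreal ((g n x - g0 x)\<^sup>2)"
        using ennreal_leI[OF *] by simp
    qed
    also have "\<dots> = 2 * (\<integral>\<^sup>+x. ennreal ((f n x - f0 x)\<^sup>2) \<partial>N) + 2 * (\<integral>\<^sup>+x. ennreal ((g n x - g0 x)\<^sup>2) \<partial>N)"
      by (subst nn_integral_add; simp add: nn_integral_cmult)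
    finally show ?thesis .
  qed
  then have le: "\<forall>\<^sub>F n in sequentially. (\<integral>\<^sup>+x. ennreal (((f n x - g n x) - (f0 x - g0 x))\<^sup>2) \<partial>N) \<le>
      2 * (\<integral>\<^sup>+x. ennreal ((f n x - f0 x)\<^sup>2) \<partial>N) + 2 * (\<integral>\<^sup>+x. ennreal ((g n x - g0 x)\<^sup>2) \<partial>N)"
    by (rule always_eventually[OF allI])
  have "(\<lambda>n. 2 * (\<integral>\<^sup>+x. ennreal ((f n x - f0 x)\<^sup>2) \<partial>N) + 2 * (\<integral>\<^sup>+x. ennreal ((g n x - g0 x)\<^sup>2) \<partial>N)) \<longlonglongrightarrow> 2 * 0 + 2 * 0"
    using lim unfolding l2_tendsto_def
    by (intro tendsto_add ennreal_tendsto_cmult) auto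
  then have lim0: "(\<lambda>n. 2 * (\<integral>\<^sup>+x. ennreal ((f n x - f0 x)\<^sup>2) \<partial>N) + 2 * (\<integral>\<^sup>+x. ennreal ((g n x - g0 x)\<^sup>2) \<partial>N)) \<longlonglongrightarrow> 0"
    by simp
  show ?thesis
    unfolding l2_tendsto_def
    by (rule tendsto_sandwich[OF _ le tendsto_const lim0]) simp
qed

section \<open>Integrals over product spaces\<close>

lemma (in pair_sigma_finite) integrable_fst_mult_snd:
  fixes f g :: "_ \<Rightarrow> real"
  assumes "integrable M1 f" "integrable M2 g"
  shows "integrable (M1 \<Otimes>\<^sub>M M2) (\<lambda>p. f (fst p) * g (snd p))"
proof (rule Fubini_integrable)
  have [measurable]: "f \<in> borel_measurable M1" "g \<in> borel_measurable M2" using assms by auto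
  show "(\<lambda>p. f (fst p) * g (snd p)) \<in> borel_measurable (M1 \<Otimes>\<^sub>M M2)" by measurable
  show "integrable M1 (\<lambda>x. \<integral>y. norm (f (fst (x, y)) * g (snd (x, y))) \<partial>M2)"
    using assms by (simp add: abs_mult)
  show "AE x in M1. integrable M2 (\<lambda>y. f (fst (x, y)) * g (snd (x, y)))"
    using assms by simp
qed

lemma (in pair_sigma_finite) square_integrable_fst_mult_snd:
  assumes "square_integrable M1 f" "square_integrable M2 g"
  shows "square_integrable (M1 \<Otimes>\<^sub>M M2) (\<lambda>p. f (fst p) * g (snd p))"
proof -
  note [measurable] = square_integrable_measurable[OF assms(1)] square_integrable_measurable[OF assms(2)]
  have "(\<lambda>p. f (fst p) * g (snd p)) \<in> borel_measurable (M1 \<Otimes>\<^sub>M M2)" by measurable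
  then show ?thesis
    using integrable_fst_mult_snd[OF square_integrableD[OF assms(1)] square_integrableD[OF assms(2)]]
    by (simp add: square_integrable_def power_mult_distrib)
qed

lemma square_integrable_indicator_Ioc [simp]:
  "square_integrable lborel (indicator {a<..b::real})"
  by (cases "a \<le> b") (auto simp: square_integrable_def power2_eq_square simp flip: indicator_inter_arith)

text \<open>The diagonal cuts the plane into two triangles that the symmetry of \<open>k\<close>
  exchanges. For \<open>k r q = x r * x q\<close> this is the integrated form of the rule that the
  square of a primitive X of x has derivative 2 x X.\<close>

lemma symmetric_double_integral:
  fixes k :: "real \<Rightarrow> real \<Rightarrow> real"
  assumes int: "integrable (lborel \<Otimes>\<^sub>M lborel) (\<lambda>(r, q). k r q)" and sym: "\<And>r q. k r q = k q r"
  shows "(\<integral>r. (\<integral>q. k r q \<partial>lborel) \<partial>lborel) =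
      2 * (\<integral>r. (\<integral>q. indicator {..r} q * k r q \<partial>lborel) \<partial>lborel)"
    and "integrable lborel (\<lambda>r. \<integral>q. indicator {..r} q * k r q \<partial>lborel)"
proof -
  have [measurable]: "(\<lambda>(r, q). k r q) \<in> borel_measurable (lborel \<Otimes>\<^sub>M lborel)"
    using int by auto
  let ?l = "\<lambda>r q. indicator {..r} q * k r q" and ?u = "\<lambda>r q. indicator {r<..} q * k r q"
  have l: "integrable (lborel \<Otimes>\<^sub>M lborel) (\<lambda>(r, q). ?l r q)"
  proof (rule Bochner_Integration.integrable_bound[OF int])
    have "(\<lambda>p. (if snd p \<le> fst p then 1 else 0) * (case p of (r, q) \<Rightarrow> k r q)) \<in> borel_measurable (lborel \<Otimes>\<^sub>M lborel)"
      by measurable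
    then show "(\<lambda>(r, q). ?l r q) \<in> borel_measurable (lborel \<Otimes>\<^sub>M lborel)"
      by (rule measurable_cong[THEN iffD1, rotated]) (auto simp: indicator_def)
  qed (auto simp: indicator_def)
  have ue: "?u r q = k r q - ?l r q" for r q by (simp add: indicator_def)
  have u: "integrable (lborel \<Otimes>\<^sub>M lborel) (\<lambda>(r, q). ?u r q)"
    using Bochner_Integration.integrable_diff[OF int l] unfolding ue by (simp add: case_prod_unfold)
  show "integrable lborel (\<lambda>r. \<integral>q. ?l r q \<partial>lborel)"
    using lborel_pair.integrable_fst[OF l] .
  have "(\<integral>r. (\<integral>q. k r q \<partial>lborel) \<partial>lborel) = integral\<^sup>L (lborel \<Otimes>\<^sub>M lborel) (\<lambda>(r, q). k r q)"
    by (rule lborel_pair.integral_fst[OF int])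
  also have "\<dots> = integral\<^sup>L (lborel \<Otimes>\<^sub>M lborel) (\<lambda>p. (case p of (r, q) \<Rightarrow> ?l r q) + (case p of (r, q) \<Rightarrow> ?u r q))"
    by (intro Bochner_Integration.integral_cong) (auto simp: ue)
  also have "\<dots> = integral\<^sup>L (lborel \<Otimes>\<^sub>M lborel) (\<lambda>(r, q). ?l r q) + integral\<^sup>L (lborel \<Otimes>\<^sub>M lborel) (\<lambda>(r, q). ?u r q)"
    by (rule Bochner_Integration.integral_add[OF l u])
  also have "integral\<^sup>L (lborel \<Otimes>\<^sub>M lborel) (\<lambda>(r, q). ?u r q) = (\<integral>q. (\<integral>r. ?u r q \<partial>lborel) \<partial>lborel)"
    by (rule lborel_pair.integral_snd[OF u, symmetric])
  also have "\<dots> = (\<integral>q. (\<integral>r. ?l q r \<partial>lborel) \<partial>lborel)"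
  proof (rule Bochner_Integration.integral_cong[OF refl])
    fix q :: real
    show "(\<integral>r. ?u r q \<partial>lborel) = (\<integral>r. ?l q r \<partial>lborel)"
    proof (rule integral_cong_AE)
      have "(\<lambda>r. indicator {..<q} r * k r q) \<in> borel_measurable lborel" by measurable
      also have "(\<lambda>r. indicator {..<q} r * k r q) = (\<lambda>r. ?u r q)" by (auto simp: indicator_def)
      finally show "(\<lambda>r. ?u r q) \<in> borel_measurable lborel" .
      show "(\<lambda>r. ?l q r) \<in> borel_measurable lborel" by measurable
      \<comment> \<open>Exchanging the variables turns the upper triangle into the lower one without
        its diagonal, hence equality only almost everywhere.\<close>
      show "AE r in lborel. ?u r q = ?l q r"
        using AE_lborel_singleton[of q] by eventually_elim (simp add: indicator_def sym[of _ q])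
    qed
  qed
  also have "integral\<^sup>L (lborel \<Otimes>\<^sub>M lborel) (\<lambda>(r, q). ?l r q) = (\<integral>r. (\<integral>q. ?l r q \<partial>lborel) \<partial>lborel)"
    by (rule lborel_pair.integral_fst[OF l, symmetric])
  finally show "(\<integral>r. (\<integral>q. k r q \<partial>lborel) \<partial>lborel) = 2 * (\<integral>r. (\<integral>q. ?l r q \<partial>lborel) \<partial>lborel)"
    by simp
qed

subsection \<open>The Ito integral\<close>

text \<open>
  The summands may have overlapping intervals. Since both the integral and the integrand are additive,
  the isometry then needs no common refinement of two grids: it is bilinear and reduces to single steps.
\<close>

inductive elementary_integral ::
  "'a measure \<Rightarrow> (real \<Rightarrow> 'a measure) \<Rightarrow> (real \<Rightarrow> 'a \<Rightarrow> real) \<Rightarrow>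
    (real \<times> 'a \<Rightarrow> real) \<Rightarrow> ('a \<Rightarrow> real) \<Rightarrow> bool"
  for M F B where
  zero: "elementary_integral M F B (\<lambda>_. 0) (\<lambda>_. 0)"
| add: "0 \<le> a \<Longrightarrow> a \<le> b \<Longrightarrow> c \<in> borel_measurable (F a) \<Longrightarrow> (\<And>\<omega>. \<omega> \<in> space M \<Longrightarrow> \<bar>c \<omega>\<bar> \<le> C) \<Longrightarrow>
    elementary_integral M F B f X \<Longrightarrow>
    elementary_integral M F B (\<lambda>p. c (snd p) * indicator {a<..b} (fst p) + f p)
      (\<lambda>\<omega>. c \<omega> * (B b \<omega> - B a \<omega>) + X \<omega>)"

context standard_brownian_motion
begin

section \<open>Moments and products of Brownian increments\<close>

lemma adapted_measurable: "X \<in> borel_measurable (F t) \<Longrightarrow> X \<in> borel_measurable M"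
  using subalgebra_F measurable_from_subalg by blast

lemma measurable_F_mono:
  assumes "X \<in> borel_measurable (F s)" "s \<le> t"
  shows "X \<in> borel_measurable (F t)"
proof -
  have "subalgebra (F t) (F s)"
    using subalgebra_F[of s] subalgebra_F[of t] sets_F_mono[of s t] assms(2)
    by (auto simp: subalgebra_def)
  then show ?thesis using assms(1) measurable_from_subalg by blast
qed

lemma B_measurable: "0 \<le> t \<Longrightarrow> B t \<in> borel_measurable M"
  using adapted adapted_measurable by blast

lemma increment_moments:
  assumes "0 \<le> a" "a \<le> b"
  shows "square_integrable M (\<lambda>\<omega>. B b \<omega> - B a \<omega>)" "(\<integral>\<omega>. B b \<omega> - B a \<omega> \<partial>M) = 0"
    "(\<integral>\<omega>. (B b \<omega> - B a \<omega>)\<^sup>2 \<partial>M) = b - a"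
proof -
  let ?D = "\<lambda>\<omega>. B b \<omega> - B a \<omega>"
  have "square_integrable M ?D \<and> expectation ?D = 0 \<and> (\<integral>\<omega>. (?D \<omega>)\<^sup>2 \<partial>M) = b - a"
  proof (cases "a = b")
    case True then show ?thesis by simp
  next
    case False
    with assms have ab: "a < b" by simp
    have s: "0 < sqrt (b - a)" using ab by simp
    have D: "distributed M lborel ?D (normal_density 0 (sqrt (b - a)))"
      by (rule normal_increments[OF assms(1) ab])
    have e: "expectation ?D = 0"
      by (rule normal_distributed_expectation[OF s D])
    have v: "(\<integral>\<omega>. (?D \<omega>)\<^sup>2 \<partial>M) = b - a"
      using normal_distributed_variance[OF s D] e ab by simp
    have "?D \<in> borel_measurable M"
      using B_measurable assms by simp
    \<comment> \<open>A Bochner integral with a nonzero value forces integrability, and the value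
      here is \<open>b - a > 0\<close>.\<close>
    moreover have "integrable M (\<lambda>\<omega>. (?D \<omega>)\<^sup>2)"
      by (rule ccontr) (use v ab not_integrable_integral_eq in force)
    ultimately show ?thesis using e v by (simp add: square_integrable_def)
  qed
  then show "square_integrable M ?D" "expectation ?D = 0" "(\<integral>\<omega>. (?D \<omega>)\<^sup>2 \<partial>M) = b - a" by auto
qed

text \<open>The map \<open>h\<close> is left free to cover both the increment and its square;
  composing with it can only shrink the sigma-algebra that the increment generates.\<close>

lemma increment_indep_var:
  assumes "0 \<le> a" "a < b" "X \<in> borel_measurable (F a)" "h \<in> borel_measurable borel"
  shows "indep_var borel X borel (\<lambda>\<omega>. h (B b \<omega> - B a \<omega>))"
proof -
  let ?D = "\<lambda>\<omega>. B b \<omega> - B a \<omega>"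
  have [measurable]: "X \<in> borel_measurable M" "?D \<in> borel_measurable M"
    using assms B_measurable adapted_measurable by auto
  note assms(4)[measurable]
  have sp: "space (F a) = space M" using subalgebra_F[of a] by (simp add: subalgebra_def)
  have "indep_set (sets (F a)) (sets (vimage_algebra (space M) ?D borel))"
    using indep_increments[of a b] assms by simp
  then have "indep_set (sigma_sets (space M) {X -` A \<inter> space M |A. A \<in> sets borel})
     (sigma_sets (space M) {(\<lambda>\<omega>. h (?D \<omega>)) -` A \<inter> space M |A. A \<in> sets borel})"
    unfolding indep_set_def
  proof (rule indep_sets_mono_sets)
    have 1: "sigma_sets (space M) {X -` A \<inter> space M |A. A \<in> sets borel} \<subseteq> sets (F a)"
      using measurable_sets[OF assms(3)] unfolding sp[symmetric] by (intro sets.sigma_sets_subset) blast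
    let ?V = "vimage_algebra (space M) ?D borel"
    have "?D \<in> borel_measurable ?V" by (rule measurable_vimage_algebra1) simp
    then have hD: "(\<lambda>\<omega>. h (?D \<omega>)) \<in> borel_measurable ?V" by simp
    have spV: "space ?V = space M" by simp
    have 2: "sigma_sets (space ?V) {(\<lambda>\<omega>. h (?D \<omega>)) -` A \<inter> space ?V |A. A \<in> sets borel} \<subseteq> sets ?V"
      using measurable_sets[OF hD] by (intro sets.sigma_sets_subset) blast
    fix i :: bool
    show "case_bool (sigma_sets (space M) {X -` A \<inter> space M |A. A \<in> sets borel})
       (sigma_sets (space M) {(\<lambda>\<omega>. h (?D \<omega>)) -` A \<inter> space M |A. A \<in> sets borel}) i
      \<subseteq> case_bool (sets (F a)) (sets ?V) i"
      using 1 2[unfolded spV] by (cases i) auto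
  qed
  then show ?thesis unfolding indep_var_eq by simp
qed

lemma increment_orthogonal:
  assumes ab: "0 \<le> a" "a \<le> b" and X: "X \<in> borel_measurable (F a)" "integrable M X"
  shows "(\<integral>\<omega>. X \<omega> * (B b \<omega> - B a \<omega>) \<partial>M) = 0"
proof (cases "a = b")
  case False
  then have i: "indep_var borel X borel (\<lambda>\<omega>. B b \<omega> - B a \<omega>)"
    using increment_indep_var[of a b X "\<lambda>x. x"] assms by simp
  have D: "integrable M (\<lambda>\<omega>. B b \<omega> - B a \<omega>)"
    by (rule square_integrable_imp_integrable[OF increment_moments(1)[OF ab]])
  show ?thesis
    using indep_var_lebesgue_integral[OF i X(2) D] increment_moments(2)[OF ab] by simp
qed simp

lemma increment_square:
  assumes ab: "0 \<le> a" "a \<le> b" and X: "X \<in> borel_measurable (F a)" "integrable M X"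
  shows "(\<integral>\<omega>. X \<omega> * (B b \<omega> - B a \<omega>)\<^sup>2 \<partial>M) = (b - a) * (\<integral>\<omega>. X \<omega> \<partial>M)"
proof (cases "a = b")
  case False
  then have i: "indep_var borel X borel (\<lambda>\<omega>. (B b \<omega> - B a \<omega>)\<^sup>2)"
    using increment_indep_var[of a b X "\<lambda>x. x\<^sup>2"] assms by simp
  have D: "integrable M (\<lambda>\<omega>. (B b \<omega> - B a \<omega>)\<^sup>2)"
    by (rule square_integrableD[OF increment_moments(1)[OF ab]])
  show ?thesis
    using indep_var_lebesgue_integral[OF i X(2) D] increment_moments(3)[OF ab] by simp
qed simp

text \<open>The coefficient is known at the later left endpoint \<open>a'\<close>. Cutting both
  increments at \<open>a'\<close> and at the earlier right endpoint isolates the overlap. In every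
  other product one factor is an increment that starts when all remaining factors are already known,
  so the expectation vanishes.\<close>

lemma increment_product:
  assumes a: "0 \<le> a" "a \<le> b" and a': "a \<le> a'" "a' \<le> b'"
    and c: "c \<in> borel_measurable (F a')" "\<And>\<omega>. \<omega> \<in> space M \<Longrightarrow> \<bar>c \<omega>\<bar> \<le> C"
  shows "(\<integral>\<omega>. c \<omega> * (B b \<omega> - B a \<omega>) * (B b' \<omega> - B a' \<omega>) \<partial>M) =
    measure lborel ({a<..b} \<inter> {a'<..b'}) * (\<integral>\<omega>. c \<omega> \<partial>M)"
proof -
  have cD: "square_integrable M (\<lambda>\<omega>. c \<omega> * (B v \<omega> - B u \<omega>))" if "0 \<le> u" "u \<le> v" for u v
    by (rule square_integrable_bounded_mult[OF increment_moments(1)[OF that] adapted_measurable[OF c(1)] c(2)])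
  have D: "square_integrable M (\<lambda>\<omega>. B v \<omega> - B u \<omega>)" if "0 \<le> u" "u \<le> v" for u v
    by (rule increment_moments(1)[OF that])
  have meas: "(\<lambda>\<omega>. c \<omega> * (B v \<omega> - B u \<omega>)) \<in> borel_measurable (F r)"
    if "0 \<le> u" "u \<le> v" "v \<le> r" "a' \<le> r" for u v r
    using measurable_F_mono[OF c(1), of r] measurable_F_mono[OF adapted, of u r]
      measurable_F_mono[OF adapted, of v r] that by simp
  have orth: "(\<integral>\<omega>. c \<omega> * (B v \<omega> - B u \<omega>) * (B t \<omega> - B r \<omega>) \<partial>M) = 0"
    if "0 \<le> u" "u \<le> v" "v \<le> r" "r \<le> t" "a' \<le> r" for u v r t
    using that by (intro increment_orthogonal meas square_integrable_imp_integrable cD) auto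
  show ?thesis
  proof (cases "b \<le> a'")
    case True
    then show ?thesis using orth[of a b a' b'] a a' by simp
  next
    case False
    define q where "q = min b b'"
    have q: "a' \<le> q" "q \<le> b" "q \<le> b'" "0 \<le> a'" "0 \<le> q" "q = b \<or> q = b'"
      using False a a' by (auto simp: q_def)
    have "{a<..b} \<inter> {a'<..b'} = {a'<..q}"
      using a a' by (auto simp: q_def)
    then have m: "measure lborel ({a<..b} \<inter> {a'<..b'}) = q - a'"
      using q by simp
    have int: "integrable M (\<lambda>\<omega>. c \<omega> * (B v \<omega> - B u \<omega>) * (B t \<omega> - B r \<omega>))"
      if "0 \<le> u" "u \<le> v" "0 \<le> r" "r \<le> t" for u v r t
      by (rule square_integrable_mult[OF cD D]) (use that in auto)
    have "(\<integral>\<omega>. c \<omega> * (B b \<omega> - B a \<omega>) * (B b' \<omega> - B a' \<omega>) \<partial>M) =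
        (\<integral>\<omega>. c \<omega> * (B a' \<omega> - B a \<omega>) * (B b' \<omega> - B a' \<omega>)
          + c \<omega> * (B q \<omega> - B a' \<omega>) * (B b' \<omega> - B q \<omega>)
          + c \<omega> * (B q \<omega> - B a' \<omega>) * (B b \<omega> - B q \<omega>)
          + c \<omega> * (B q \<omega> - B a' \<omega>) * (B q \<omega> - B a' \<omega>) \<partial>M)"
      \<comment> \<open>The product of the two tails beyond \<open>q\<close> is absent because
        \<open>q\<close> is one of the two right endpoints.\<close>
      using q(6) by (intro Bochner_Integration.integral_cong) (auto simp: algebra_simps)
    also have "\<dots> = (\<integral>\<omega>. c \<omega> * (B q \<omega> - B a' \<omega>) * (B q \<omega> - B a' \<omega>) \<partial>M)"
      using a a' q by (simp add: int orth)
    also have "\<dots> = (q - a') * (\<integral>\<omega>. c \<omega> \<partial>M)"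
      using increment_square[OF q(4) q(1) c(1) integrable_const_bound[of c C]]
        adapted_measurable[OF c(1)] c(2)
      by (simp add: power2_eq_square mult.assoc)
    finally show ?thesis using m by simp
  qed
qed

lemma pair_sigma_finite_lborel: "pair_sigma_finite lborel M"
  by unfold_locales

section \<open>Isometry and truncation for elementary integrals\<close>

lemma step_square_integrable:
  assumes c: "c \<in> borel_measurable M" "\<And>\<omega>. \<omega> \<in> space M \<Longrightarrow> \<bar>c \<omega>\<bar> \<le> C"
  shows "square_integrable (lborel \<Otimes>\<^sub>M M) (\<lambda>p. c (snd p) * indicator {a<..b::real} (fst p))"
proof -
  have "emeasure (lborel \<Otimes>\<^sub>M M) ({a<..b} \<times> space M) < \<infinity>"
    by (subst emeasure_pair_measure_Times; cases "a \<le> b") (auto simp: emeasure_space_1)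
  then have i: "square_integrable (lborel \<Otimes>\<^sub>M M) (indicator ({a<..b} \<times> space M))"
    by (auto simp: square_integrable_def power2_eq_square simp flip: indicator_inter_arith)
  have m: "(\<lambda>p. c (snd p)) \<in> borel_measurable (lborel \<Otimes>\<^sub>M M)" using c(1) by simp
  show ?thesis
    using square_integrable_bounded_mult[OF i m c(2)]
    by (rule square_integrable_cong[THEN iffD1, rotated])
      (auto simp: space_pair_measure indicator_def)
qed

lemma integral_step_product:
  assumes c: "c \<in> borel_measurable M" "\<And>\<omega>. \<omega> \<in> space M \<Longrightarrow> \<bar>c \<omega>\<bar> \<le> C"
    and d: "d \<in> borel_measurable M" "\<And>\<omega>. \<omega> \<in> space M \<Longrightarrow> \<bar>d \<omega>\<bar> \<le> C'"
  shows "(\<integral>p. (c (snd p) * indicator {a<..b} (fst p)) * (d (snd p) * indicator {a'<..b'} (fst p)) \<partial>(lborel \<Otimes>\<^sub>M M))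
    = measure lborel ({a<..b} \<inter> {a'<..b'::real}) * (\<integral>\<omega>. c \<omega> * d \<omega> \<partial>M)" (is "integral\<^sup>L _ ?f = _")
proof -
  interpret P: pair_sigma_finite lborel M by (rule pair_sigma_finite_lborel)
  have "integrable (lborel \<Otimes>\<^sub>M M) ?f"
    by (rule square_integrable_mult[OF step_square_integrable[OF c] step_square_integrable[OF d]])
  from P.integral_fst'[OF this]
  have "integral\<^sup>L (lborel \<Otimes>\<^sub>M M) ?f =
      (\<integral>s. (\<integral>\<omega>. indicator ({a<..b} \<inter> {a'<..b'}) s * (c \<omega> * d \<omega>) \<partial>M) \<partial>lborel)"
    by (simp only: fst_conv snd_conv indicator_inter_arith mult_ac)
  also have "\<dots> = measure lborel ({a<..b} \<inter> {a'<..b'}) * (\<integral>\<omega>. c \<omega> * d \<omega> \<partial>M)"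
    by (simp del: Int_greaterThanAtMost)
  finally show ?thesis .
qed

text \<open>By the time the later of the two steps starts, both coefficients are known, so their
  product can serve as the coefficient in \<open>increment_product\<close>. The two cases exchange
  the roles of the steps.\<close>

lemma step_isometry:
  assumes a: "0 \<le> a" "a \<le> b" and c: "c \<in> borel_measurable (F a)" "\<And>\<omega>. \<omega> \<in> space M \<Longrightarrow> \<bar>c \<omega>\<bar> \<le> C"
    and a': "0 \<le> a'" "a' \<le> b'" and d: "d \<in> borel_measurable (F a')" "\<And>\<omega>. \<omega> \<in> space M \<Longrightarrow> \<bar>d \<omega>\<bar> \<le> C'"
  shows "(\<integral>\<omega>. (c \<omega> * (B b \<omega> - B a \<omega>)) * (d \<omega> * (B b' \<omega> - B a' \<omega>)) \<partial>M) =
    (\<integral>p. (c (snd p) * indicator {a<..b} (fst p)) * (d (snd p) * indicator {a'<..b'} (fst p)) \<partial>(lborel \<Otimes>\<^sub>M M))"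
proof -
  have cm: "c \<in> borel_measurable M" "d \<in> borel_measurable M"
    using c d adapted_measurable by auto
  have bd: "\<bar>c \<omega> * d \<omega>\<bar> \<le> C * C'" if "\<omega> \<in> space M" for \<omega>
    using mult_mono[OF c(2)[OF that] d(2)[OF that]] c(2)[OF that] by (simp add: abs_mult)
  have "(\<integral>\<omega>. (c \<omega> * (B b \<omega> - B a \<omega>)) * (d \<omega> * (B b' \<omega> - B a' \<omega>)) \<partial>M) =
      measure lborel ({a<..b} \<inter> {a'<..b'}) * (\<integral>\<omega>. c \<omega> * d \<omega> \<partial>M)"
  proof (cases "a \<le> a'")
    case True
    have "(\<lambda>\<omega>. c \<omega> * d \<omega>) \<in> borel_measurable (F a')"
      using measurable_F_mono[OF c(1) True] d(1) by simp
    from increment_product[OF a True a'(2) this bd] show ?thesis by (simp add: mult_ac)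
  next
    case False
    then have "a' \<le> a" by simp
    have "(\<lambda>\<omega>. c \<omega> * d \<omega>) \<in> borel_measurable (F a)"
      using measurable_F_mono[OF d(1) \<open>a' \<le> a\<close>] c(1) by simp
    from increment_product[OF a' \<open>a' \<le> a\<close> a(2) this bd] show ?thesis
      by (simp add: mult_ac Int_commute)
  qed
  with integral_step_product[OF cm(1) c(2) cm(2) d(2)] show ?thesis by simp
qed

abbreviation elementary :: "(real \<times> 'a \<Rightarrow> real) \<Rightarrow> ('a \<Rightarrow> real) \<Rightarrow> bool" where
  "elementary \<equiv> elementary_integral M F B"

lemma elementary_square_integrable:
  assumes "elementary f X"
  shows "square_integrable (lborel \<Otimes>\<^sub>M M) f" "square_integrable M X"
proof -
  have "square_integrable (lborel \<Otimes>\<^sub>M M) f \<and> square_integrable M X"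
    using assms
  proof induction
    case (add a b c C f X)
    note cm = adapted_measurable[OF add(3)]
    show ?case
      using square_integrable_add[OF step_square_integrable[OF cm add(4)] conjunct1[OF add.IH]]
        square_integrable_add[OF square_integrable_bounded_mult[OF increment_moments(1)[OF add(1,2)] cm add(4)]
          conjunct2[OF add.IH]] by blast
  qed simp
  then show "square_integrable (lborel \<Otimes>\<^sub>M M) f" "square_integrable M X" by auto
qed

text \<open>Bilinearity is used one argument at a time: this induction expands \<open>f\<close>
  against a single step, and \<open>elementary_isometry\<close> expands the other argument.\<close>

lemma elementary_inner_step:
  assumes d: "0 \<le> a'" "a' \<le> b'" "d \<in> borel_measurable (F a')" "\<And>\<omega>. \<omega> \<in> space M \<Longrightarrow> \<bar>d \<omega>\<bar> \<le> C'"
    and "elementary f X"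
  shows "(\<integral>\<omega>. X \<omega> * (d \<omega> * (B b' \<omega> - B a' \<omega>)) \<partial>M) =
     (\<integral>p. f p * (d (snd p) * indicator {a'<..b'} (fst p)) \<partial>(lborel \<Otimes>\<^sub>M M))"
  using assms(5)
proof induction
  case (add a b c C f X)
  note cm = adapted_measurable[OF add(3)] note dm = adapted_measurable[OF d(3)]
  note E = elementary_square_integrable[OF add(5)]
  note cs = square_integrable_bounded_mult[OF increment_moments(1)[OF add(1,2)] cm add(4)]
  note ds = square_integrable_bounded_mult[OF increment_moments(1)[OF d(1,2)] dm d(4)]
  note cs' = step_square_integrable[OF cm add(4)] note ds' = step_square_integrable[OF dm d(4)]
  show ?case
    using square_integrable_mult[OF cs ds] square_integrable_mult[OF E(2) ds]
      square_integrable_mult[OF cs' ds'] square_integrable_mult[OF E(1) ds'] add.IH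
      step_isometry[OF add(1-4) d]
    by (simp add: ring_distribs(2))
qed simp

lemma elementary_isometry:
  assumes "elementary f X" "elementary g Y"
  shows "(\<integral>\<omega>. X \<omega> * Y \<omega> \<partial>M) = (\<integral>p. f p * g p \<partial>(lborel \<Otimes>\<^sub>M M))"
  using assms(2)
proof induction
  case (add a b c C g Y)
  note cm = adapted_measurable[OF add(3)]
  note E = elementary_square_integrable[OF add(5)]
  note E' = elementary_square_integrable[OF assms(1)]
  note cs = square_integrable_bounded_mult[OF increment_moments(1)[OF add(1,2)] cm add(4)]
  note cs' = step_square_integrable[OF cm add(4)]
  show ?case
    using square_integrable_mult[OF E'(2) cs] square_integrable_mult[OF E'(2) E(2)]
      square_integrable_mult[OF E'(1) cs'] square_integrable_mult[OF E'(1) E(1)] add.IH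
      elementary_inner_step[OF add(1-4) assms(1)]
    by (simp add: ring_distribs(1))
qed simp

lemma elementary_add:
  assumes "elementary f X" "elementary g Y"
  shows "elementary (\<lambda>p. f p + g p) (\<lambda>\<omega>. X \<omega> + Y \<omega>)"
  using assms(1)
proof induction
  case (add a b c C f X)
  from elementary_integral.add[OF add(1-4) add.IH] show ?case by (simp add: add.assoc)
qed (use assms(2) in simp)

lemma elementary_uminus:
  assumes "elementary f X"
  shows "elementary (\<lambda>p. - f p) (\<lambda>\<omega>. - X \<omega>)"
  using assms
proof induction
  case zero show ?case using elementary_integral.zero by simp
next
  case (add a b c C f X)
  have "elementary (\<lambda>p. (- c (snd p)) * indicator {a<..b} (fst p) + (- f p))
      (\<lambda>\<omega>. (- c \<omega>) * (B b \<omega> - B a \<omega>) + (- X \<omega>))"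
    using add by (intro elementary_integral.add[where C=C]) auto
  then show ?case by (simp add: algebra_simps)
qed

lemma elementary_diff:
  "elementary f X \<Longrightarrow> elementary g Y \<Longrightarrow> elementary (\<lambda>p. f p - g p) (\<lambda>\<omega>. X \<omega> - Y \<omega>)"
  using elementary_add[OF _ elementary_uminus, of f X g Y] by simp

text \<open>Each step is cut at \<open>s\<close>. What remains is driven by increments after
  \<open>s\<close>, which are orthogonal to everything square integrable that is known at
  \<open>s\<close>. The induction carries this orthogonality for all \<open>Y\<close> together with
  the existence of the truncated integral.\<close>

lemma elementary_truncate:
  assumes "elementary f X" "0 \<le> s"
  obtains X' where "elementary (\<lambda>p. f p * indicator {s<..} (fst p)) X'"
    "\<And>Y. square_integrable M Y \<Longrightarrow> Y \<in> borel_measurable (F s) \<Longrightarrow> (\<integral>\<omega>. Y \<omega> * X' \<omega> \<partial>M) = 0"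
proof -
  have "\<exists>X'. elementary (\<lambda>p. f p * indicator {s<..} (fst p)) X' \<and>
    (\<forall>Y. square_integrable M Y \<and> Y \<in> borel_measurable (F s) \<longrightarrow> (\<integral>\<omega>. Y \<omega> * X' \<omega> \<partial>M) = 0)"
    using assms(1)
  proof induction
    case zero
    show ?case using elementary_integral.zero by (intro exI[of _ "\<lambda>_. 0"]) simp
  next
    case (add a b c C f X)
    then obtain X' where X': "elementary (\<lambda>p. f p * indicator {s<..} (fst p)) X'"
      "\<And>Y. square_integrable M Y \<Longrightarrow> Y \<in> borel_measurable (F s) \<Longrightarrow> (\<integral>\<omega>. Y \<omega> * X' \<omega> \<partial>M) = 0"
      by blast
    \<comment> \<open>A step that ends before \<open>s\<close> collapses to the empty interval
      \<open>{s<..s}\<close> with zero increment.\<close>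
    let ?a = "max a s" and ?b = "max b s"
    have ab: "0 \<le> ?a" "?a \<le> ?b" using add by auto
    have ca: "c \<in> borel_measurable (F ?a)" by (rule measurable_F_mono[OF add(3)]) simp
    let ?X = "\<lambda>\<omega>. c \<omega> * (B ?b \<omega> - B ?a \<omega>) + X' \<omega>"
    have "elementary (\<lambda>p. c (snd p) * indicator {?a<..?b} (fst p) + f p * indicator {s<..} (fst p)) ?X"
      by (rule elementary_integral.add[OF ab ca add(4) X'(1)])
    moreover have "c (snd p) * indicator {?a<..?b} (fst p) + f p * indicator {s<..} (fst p) =
        (c (snd p) * indicator {a<..b} (fst p) + f p) * indicator {s<..} (fst p)" for p :: "real \<times> 'a"
      by (auto simp: indicator_def)
    moreover have "(\<integral>\<omega>. Y \<omega> * ?X \<omega> \<partial>M) = 0"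
      if Y: "square_integrable M Y" "Y \<in> borel_measurable (F s)" for Y
    proof -
      have Yc: "square_integrable M (\<lambda>\<omega>. c \<omega> * Y \<omega>)"
        by (rule square_integrable_bounded_mult[OF Y(1) adapted_measurable[OF ca] add(4)])
      have Ya: "Y \<in> borel_measurable (F ?a)" by (rule measurable_F_mono[OF Y(2)]) simp
      have "(\<integral>\<omega>. (c \<omega> * Y \<omega>) * (B ?b \<omega> - B ?a \<omega>) \<partial>M) = 0"
        using ca Ya by (intro increment_orthogonal[OF ab] square_integrable_imp_integrable[OF Yc]) simp
      then show ?thesis
        using square_integrable_mult[OF Yc increment_moments(1)[OF ab]] X'(2)[OF Y]
          square_integrable_mult[OF Y(1) elementary_square_integrable(2)[OF X'(1)]]
        by (simp add: ring_distribs(1) mult_ac)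
    qed
    ultimately show ?case by (intro exI[of _ ?X]) simp
  qed
  with that show thesis by blast
qed

section \<open>The stochastic integral as a mean-square closure\<close>

text \<open>There is no time horizon: integrands live on the whole line and carry an indicator of
  their interval, so that integrals up to different times can be subtracted.\<close>

definition stochastic_integral :: "(real \<times> 'a \<Rightarrow> real) \<Rightarrow> ('a \<Rightarrow> real) \<Rightarrow> bool" where
  "stochastic_integral f X \<longleftrightarrow>
     f \<in> borel_measurable (lborel \<Otimes>\<^sub>M M) \<and> X \<in> borel_measurable M \<and>
     (\<exists>g Y. (\<forall>n. elementary (g n) (Y n)) \<and> l2_tendsto (lborel \<Otimes>\<^sub>M M) g f \<and> l2_tendsto M Y X)"

lemma stochastic_integral_measurable:
  assumes "stochastic_integral f X"
  shows "f \<in> borel_measurable (lborel \<Otimes>\<^sub>M M)" "X \<in> borel_measurable M"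
  using assms by (auto simp: stochastic_integral_def)

lemma stochastic_integralE:
  assumes "stochastic_integral f X"
  obtains g Y where "\<And>n. elementary (g n) (Y n)"
    "l2_tendsto (lborel \<Otimes>\<^sub>M M) g f" "l2_tendsto M Y X"
  using assms unfolding stochastic_integral_def by blast

lemma
  assumes "stochastic_integral f X"
  shows stochastic_integral_square_integrable: "square_integrable (lborel \<Otimes>\<^sub>M M) f" "square_integrable M X"
    and stochastic_integral_isometry: "(\<integral>\<omega>. (X \<omega>)\<^sup>2 \<partial>M) = (\<integral>p. (f p)\<^sup>2 \<partial>(lborel \<Otimes>\<^sub>M M))"
proof -
  obtain g Y where H0: "\<And>n. elementary (g n) (Y n)"
    "l2_tendsto (lborel \<Otimes>\<^sub>M M) g f" "l2_tendsto M Y X"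
    by (rule stochastic_integralE[OF assms]) blast
  note H = H0(1) elementary_square_integrable[OF H0(1)]
    stochastic_integral_measurable[OF assms] H0(2,3)
  show "square_integrable (lborel \<Otimes>\<^sub>M M) f" "square_integrable M X"
    by (rule square_integrable_l2_limit[OF H(2,4,6)], rule square_integrable_l2_limit[OF H(3,5,7)])
  have "(\<integral>\<omega>. (Y n \<omega>)\<^sup>2 \<partial>M) = (\<integral>p. (g n p)\<^sup>2 \<partial>(lborel \<Otimes>\<^sub>M M))" for n
    using elementary_isometry[OF H(1)[of n] H(1)[of n]] by (simp add: power2_eq_square)
  then show "(\<integral>\<omega>. (X \<omega>)\<^sup>2 \<partial>M) = (\<integral>p. (f p)\<^sup>2 \<partial>(lborel \<Otimes>\<^sub>M M))"
    using l2_tendsto_integral_square[OF H(2,4,6)] l2_tendsto_integral_square[OF H(3,5,7)]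
    by (simp add: LIMSEQ_unique)
qed

lemma stochastic_integral_diff:
  assumes "stochastic_integral f X" "stochastic_integral f' X'"
  shows "stochastic_integral (\<lambda>p. f p - f' p) (\<lambda>\<omega>. X \<omega> - X' \<omega>)"
proof -
  obtain g Y where H0: "\<And>n. elementary (g n) (Y n)"
    "l2_tendsto (lborel \<Otimes>\<^sub>M M) g f" "l2_tendsto M Y X"
    by (rule stochastic_integralE[OF assms(1)]) blast
  note H = H0(1) elementary_square_integrable[OF H0(1)]
    stochastic_integral_measurable[OF assms(1)] H0(2,3)
  obtain g' Y' where G0: "\<And>n. elementary (g' n) (Y' n)"
    "l2_tendsto (lborel \<Otimes>\<^sub>M M) g' f'" "l2_tendsto M Y' X'"
    by (rule stochastic_integralE[OF assms(2)]) blast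
  note G = G0(1) elementary_square_integrable[OF G0(1)]
    stochastic_integral_measurable[OF assms(2)] G0(2,3)
  have "(\<lambda>p. f p - f' p) \<in> borel_measurable (lborel \<Otimes>\<^sub>M M)"
    using H(4) G(4) by simp
  moreover have "(\<lambda>\<omega>. X \<omega> - X' \<omega>) \<in> borel_measurable M"
    using H(5) G(5) by simp
  moreover have "elementary (\<lambda>p. g n p - g' n p) (\<lambda>\<omega>. Y n \<omega> - Y' n \<omega>)" for n
    by (rule elementary_diff[OF H(1) G(1)])
  moreover have "l2_tendsto (lborel \<Otimes>\<^sub>M M) (\<lambda>n p. g n p - g' n p) (\<lambda>p. f p - f' p)"
    by (rule l2_tendsto_diff[OF H(2)[THEN square_integrable_measurable]
          G(2)[THEN square_integrable_measurable] H(4) G(4) H(6) G(6)])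
  moreover have "l2_tendsto M (\<lambda>n \<omega>. Y n \<omega> - Y' n \<omega>) (\<lambda>\<omega>. X \<omega> - X' \<omega>)"
    by (rule l2_tendsto_diff[OF H(3)[THEN square_integrable_measurable]
          G(3)[THEN square_integrable_measurable] H(5) G(5) H(7) G(7)])
  ultimately show ?thesis
    unfolding stochastic_integral_def by (intro conjI exI[of _ "\<lambda>n p. g n p - g' n p"]
      exI[of _ "\<lambda>n \<omega>. Y n \<omega> - Y' n \<omega>"]) auto
qed

text \<open>This is the martingale property without conditional expectations. The approximants need
  not vanish up to \<open>s\<close>. Their parts after \<open>s\<close> are orthogonal to
  \<open>Y\<close>. Since \<open>f\<close> is zero up to \<open>s\<close>, their parts up to
  \<open>s\<close> are at most as large as the approximation error, and by the isometry and
  Cauchy-Schwarz their contribution tends to zero.\<close>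

lemma stochastic_integral_orthogonal:
  assumes "stochastic_integral f X" and s: "0 \<le> s"
    and f0: "\<And>r \<omega>. r \<le> s \<Longrightarrow> f (r, \<omega>) = 0"
    and Y: "square_integrable M Y" "Y \<in> borel_measurable (F s)"
  shows "(\<integral>\<omega>. Y \<omega> * X \<omega> \<partial>M) = 0"
proof -
  let ?P = "lborel \<Otimes>\<^sub>M M"
  obtain g Z where H0: "\<And>n. elementary (g n) (Z n)"
    "l2_tendsto (lborel \<Otimes>\<^sub>M M) g f" "l2_tendsto M Z X"
    by (rule stochastic_integralE[OF assms(1)]) blast
  note H = H0(1) elementary_square_integrable[OF H0(1)]
    stochastic_integral_measurable[OF assms(1)] H0(2,3)
  have f: "square_integrable ?P f" using stochastic_integral_square_integrable[OF assms(1)] by simp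
  have bound: "norm ((\<integral>\<omega>. Z n \<omega> * Y \<omega> \<partial>M)\<^sup>2) \<le> (\<integral>p. (g n p - f p)\<^sup>2 \<partial>?P) * (\<integral>\<omega>. (Y \<omega>)\<^sup>2 \<partial>M)" for n
  proof -
    obtain Z' where Z': "elementary (\<lambda>p. g n p * indicator {s<..} (fst p)) Z'" "(\<integral>\<omega>. Y \<omega> * Z' \<omega> \<partial>M) = 0"
      using elementary_truncate[OF H(1)[of n] s] Y by metis
    let ?g = "\<lambda>p. g n p - g n p * indicator {s<..} (fst p)" and ?Z = "\<lambda>\<omega>. Z n \<omega> - Z' \<omega>"
    have E: "elementary ?g ?Z" by (rule elementary_diff[OF H(1) Z'(1)])
    note S = elementary_square_integrable[OF E]
    have "(\<integral>\<omega>. Z n \<omega> * Y \<omega> \<partial>M) = (\<integral>\<omega>. ?Z \<omega> * Y \<omega> \<partial>M)"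
      using Z'(2) square_integrable_mult[OF H(3)[of n] Y(1)]
        square_integrable_mult[OF elementary_square_integrable(2)[OF Z'(1)] Y(1)]
      by (simp add: left_diff_distrib mult.commute[of "Y _"])
    then have "norm ((\<integral>\<omega>. Z n \<omega> * Y \<omega> \<partial>M)\<^sup>2) \<le> (\<integral>\<omega>. (?Z \<omega>)\<^sup>2 \<partial>M) * (\<integral>\<omega>. (Y \<omega>)\<^sup>2 \<partial>M)"
      using Cauchy_Schwarz_integral[OF S(2) Y(1)] by simp
    also have "(\<integral>\<omega>. (?Z \<omega>)\<^sup>2 \<partial>M) = (\<integral>p. (?g p)\<^sup>2 \<partial>?P)"
      using elementary_isometry[OF E E] by (simp add: power2_eq_square)
    also have "(\<integral>p. (?g p)\<^sup>2 \<partial>?P) \<le> (\<integral>p. (g n p - f p)\<^sup>2 \<partial>?P)"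
    proof (rule integral_mono)
      show "integrable ?P (\<lambda>p. (?g p)\<^sup>2)" by (rule square_integrableD[OF S(1)])
      show "integrable ?P (\<lambda>p. (g n p - f p)\<^sup>2)"
        by (rule square_integrableD[OF square_integrable_diff[OF H(2) f]])
      show "(?g p)\<^sup>2 \<le> (g n p - f p)\<^sup>2" for p
        using f0[of "fst p" "snd p"] by (cases "fst p \<le> s") (auto simp: indicator_def)
    qed
    finally show ?thesis by (simp add: mult_right_mono)
  qed
  have "(\<lambda>n. (\<integral>p. (g n p - f p)\<^sup>2 \<partial>?P) * (\<integral>\<omega>. (Y \<omega>)\<^sup>2 \<partial>M)) \<longlonglongrightarrow> 0"
    by (rule tendsto_mult_left_zero[OF l2_tendsto_integral_square_diff[OF H(2,4,6)]])
  then have "(\<lambda>n. (\<integral>\<omega>. Z n \<omega> * Y \<omega> \<partial>M)\<^sup>2) \<longlonglongrightarrow> 0"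
    by (rule Lim_null_comparison[OF always_eventually[OF allI[OF bound]]])
  then have "(\<lambda>n. \<integral>\<omega>. Z n \<omega> * Y \<omega> \<partial>M) \<longlonglongrightarrow> 0"
    by (simp add: power_tendsto_0_iff)
  with l2_tendsto_integral_mult[OF H(3,5,7) Y(1)] have "(\<integral>\<omega>. X \<omega> * Y \<omega> \<partial>M) = 0"
    by (rule LIMSEQ_unique)
  then show ?thesis by (simp add: mult.commute)
qed

section \<open>From simple processes to the closure\<close>

lemma simple_process_elementary:
  assumes \<phi>: "simple_process_on M F T \<phi>"
  shows "elementary (\<lambda>p. simple_value \<phi> (fst p) (snd p)) (simple_ito_integral B \<phi>)"
    and "\<And>s \<omega>. s \<le> 0 \<or> T < s \<Longrightarrow> simple_value \<phi> s \<omega> = 0"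
proof -
  note D = \<phi>[unfolded simple_process_on_def]
  have mono: "grid \<phi> i \<le> grid \<phi> j" if "i \<le> j" "j \<le> steps \<phi>" for i j
    using that
  proof (induction j rule: dec_induct)
    case (step k)
    then have "grid \<phi> k < grid \<phi> (Suc k)" using D by auto
    with step show ?case by simp
  qed simp
  have g0: "0 \<le> grid \<phi> i" if "i \<le> steps \<phi>" for i using mono[of 0 i] that D by simp
  have gT: "grid \<phi> i \<le> T" if "i \<le> steps \<phi>" for i using mono[of i "steps \<phi>"] that D by simp
  have "elementary (\<lambda>p. \<Sum>i<k. coeff \<phi> i (snd p) * indicator {grid \<phi> i<..grid \<phi> (Suc i)} (fst p))
      (\<lambda>\<omega>. \<Sum>i<k. coeff \<phi> i \<omega> * (B (grid \<phi> (Suc i)) \<omega> - B (grid \<phi> i) \<omega>))"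
    if "k \<le> steps \<phi>" for k
    using that
  proof (induction k)
    case 0
    show ?case using elementary_integral.zero by simp
  next
    case (Suc k)
    then have k: "k < steps \<phi>" by simp
    with D obtain C where C: "\<And>\<omega>. \<omega> \<in> space M \<Longrightarrow> \<bar>coeff \<phi> k \<omega>\<bar> \<le> C" by blast
    have g: "0 \<le> grid \<phi> k" using g0[of k] k by simp
    have "grid \<phi> k \<le> grid \<phi> (Suc k)" "coeff \<phi> k \<in> borel_measurable (F (grid \<phi> k))"
      using D k by (auto intro: less_imp_le)
    from elementary_integral.add[OF g this C Suc.IH] k show ?case
      by (simp add: add.commute)
  qed
  from this[OF order_refl] show "elementary (\<lambda>p. simple_value \<phi> (fst p) (snd p)) (simple_ito_integral B \<phi>)"
    by (simp add: simple_value_def simple_ito_integral_def[abs_def])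
  fix s \<omega> assume "s \<le> 0 \<or> T < s"
  then have "\<not> (grid \<phi> i < s \<and> s \<le> grid \<phi> (Suc i))" if "i < steps \<phi>" for i
    using g0[of i] gT[of "Suc i"] that by auto
  then show "simple_value \<phi> s \<omega> = 0"
    unfolding simple_value_def by (intro sum.neutral) (auto simp: indicator_def)
qed

text \<open>Simple processes vanish at time 0 and outside the horizon. Extending the integrand by
  zero off \<open>{0<..T}\<close> therefore adds no error, and at time 0 it can only remove
  some.\<close>

lemma has_ito_integral_stochastic_integral:
  assumes I: "has_ito_integral M F B T f I" and T: "0 \<le> T"
  shows "stochastic_integral (\<lambda>p. indicator {0<..T} (fst p) * f (fst p) (snd p)) I"
proof -
  let ?P = "lborel \<Otimes>\<^sub>M M" and ?f = "\<lambda>p. indicator {0<..T} (fst p) * f (fst p) (snd p)"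
  interpret P: pair_sigma_finite lborel M by (rule pair_sigma_finite_lborel)
  obtain \<phi> where \<phi>: "\<And>n. simple_process_on M F T (\<phi> n)"
    "(\<lambda>n. \<integral>\<^sup>+\<omega>. (\<integral>\<^sup>+s\<in>{0..T}. ennreal ((simple_value (\<phi> n) s \<omega> - f s \<omega>)\<^sup>2) \<partial>lborel) \<partial>M) \<longlonglongrightarrow> 0"
    "l2_tendsto M (\<lambda>n. simple_ito_integral B (\<phi> n)) I"
    using I unfolding has_ito_integral_def l2_tendsto_def by blast
  have Im: "I \<in> borel_measurable M" using I by (simp add: has_ito_integral_def)
  have fm: "(\<lambda>(s, \<omega>). f s \<omega>) \<in> borel_measurable (restrict_space borel {0..T} \<Otimes>\<^sub>M M)"
    using I by (simp add: has_ito_integral_def ito_integrand_def)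
  \<comment> \<open>Joint measurability is given only for times in \<open>{0..T}\<close>. Clamping
    the time carries it to the whole line, and the indicator hides the clamping.\<close>
  have "(\<lambda>p. max 0 (min T (fst p))) \<in> ?P \<rightarrow>\<^sub>M restrict_space borel {0..T}"
    using T by (intro measurable_restrict_space2) auto
  then have "(\<lambda>p. (max 0 (min T (fst p)), snd p)) \<in> ?P \<rightarrow>\<^sub>M restrict_space borel {0..T} \<Otimes>\<^sub>M M"
    by (intro measurable_Pair) auto
  from measurable_compose[OF this fm]
  have "(\<lambda>p. indicator {0<..T} (fst p) * f (max 0 (min T (fst p))) (snd p)) \<in> borel_measurable ?P"
    by simp
  also have "(\<lambda>p. indicator {0<..T} (fst p) * f (max 0 (min T (fst p))) (snd p)) = ?f"
    by (auto simp: indicator_def fun_eq_iff)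
  finally have fP: "?f \<in> borel_measurable ?P" .
  have el: "elementary (\<lambda>p. simple_value (\<phi> n) (fst p) (snd p)) (simple_ito_integral B (\<phi> n))" for n
    by (rule simple_process_elementary(1)[OF \<phi>(1)])
  have sm: "(\<lambda>p. simple_value (\<phi> n) (fst p) (snd p)) \<in> borel_measurable ?P" for n
    by (rule square_integrable_measurable[OF elementary_square_integrable(1)[OF el]])
  have le: "(\<integral>\<^sup>+p. ennreal ((simple_value (\<phi> n) (fst p) (snd p) - ?f p)\<^sup>2) \<partial>?P) \<le>
      (\<integral>\<^sup>+\<omega>. (\<integral>\<^sup>+s\<in>{0..T}. ennreal ((simple_value (\<phi> n) s \<omega> - f s \<omega>)\<^sup>2) \<partial>lborel) \<partial>M)" for n
  proof -
    have "(\<integral>\<^sup>+p. ennreal ((simple_value (\<phi> n) (fst p) (snd p) - ?f p)\<^sup>2) \<partial>?P) =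
       (\<integral>\<^sup>+\<omega>. (\<integral>\<^sup>+s. ennreal ((simple_value (\<phi> n) s \<omega> - ?f (s, \<omega>))\<^sup>2) \<partial>lborel) \<partial>M)"
      using P.nn_integral_snd[of "\<lambda>p. ennreal ((simple_value (\<phi> n) (fst p) (snd p) - ?f p)\<^sup>2)"] sm[of n] fP
      by simp
    also have "\<dots> \<le> (\<integral>\<^sup>+\<omega>. (\<integral>\<^sup>+s\<in>{0..T}. ennreal ((simple_value (\<phi> n) s \<omega> - f s \<omega>)\<^sup>2) \<partial>lborel) \<partial>M)"
    proof (intro nn_integral_mono)
      fix s \<omega>
      show "ennreal ((simple_value (\<phi> n) s \<omega> - ?f (s, \<omega>))\<^sup>2) \<le>
          ennreal ((simple_value (\<phi> n) s \<omega> - f s \<omega>)\<^sup>2) * indicator {0..T} s"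
        using simple_process_elementary(2)[OF \<phi>(1)[of n], of s \<omega>]
        by (cases "0 < s \<and> s \<le> T") (auto simp: indicator_def)
    qed
    finally show ?thesis .
  qed
  have "l2_tendsto ?P (\<lambda>n p. simple_value (\<phi> n) (fst p) (snd p)) ?f"
    unfolding l2_tendsto_def
    by (rule tendsto_sandwich[OF _ always_eventually[OF allI[OF le]] tendsto_const \<phi>(2)]) simp
  with el \<phi>(3) fP Im show ?thesis
    unfolding stochastic_integral_def
    by (intro conjI exI[of _ "\<lambda>n p. simple_value (\<phi> n) (fst p) (snd p)"]
        exI[of _ "\<lambda>n. simple_ito_integral B (\<phi> n)"]) auto
qed

end

subsection \<open>The delay equation\<close>

locale delay_equation = standard_brownian_motion M F B
  for M :: "'a measure" and F :: "real \<Rightarrow> 'a measure" and B :: "real \<Rightarrow> 'a \<Rightarrow> real" +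
  fixes \<tau> \<sigma> :: real and w0 :: "real \<Rightarrow> real" and w :: "real \<Rightarrow> 'a \<Rightarrow> real"
  assumes \<tau>_pos: "0 < \<tau>" and solution: "sdde_solution M F B \<tau> \<sigma> w0 w"
begin

interpretation P: pair_sigma_finite lborel M by (rule pair_sigma_finite_lborel)

section \<open>The extended process, its energy and its path integrals\<close>

text \<open>Extension by zero gives a process that is jointly measurable on the whole line, so that
  moments and integrals over arbitrary windows need no lower bound on time.\<close>

definition W :: "real \<Rightarrow> 'a \<Rightarrow> real" where
  "W r \<omega> = (if -\<tau> \<le> r then w r \<omega> else 0)"

definition path_integral :: "real \<Rightarrow> real \<Rightarrow> 'a \<Rightarrow> real" where
  "path_integral a b \<omega> = (\<integral>r. indicator {a<..b} r * W r \<omega> \<partial>lborel)"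

definition second_moment :: "real \<Rightarrow> real" where
  "second_moment r = (\<integral>\<omega>. (W r \<omega>)\<^sup>2 \<partial>M)"

definition energy :: "real \<Rightarrow> real \<Rightarrow> real" where
  "energy a b = (\<integral>r. indicator {a<..b} r * second_moment r \<partial>lborel)"

text \<open>A solution comes with one stochastic integral per time, unrelated across times; fix a choice.\<close>

definition noise :: "real \<Rightarrow> 'a \<Rightarrow> real" where
  "noise t = (SOME I. has_ito_integral M F B t (\<lambda>s. w (s - \<tau>)) I \<and>
     (AE \<omega> in M. w t \<omega> = w0 0 - (LBINT s:{0..t}. w (s - \<tau>) \<omega>) + \<sigma> * I \<omega>))"

lemma noise:
  assumes "0 \<le> t"
  shows "has_ito_integral M F B t (\<lambda>s. w (s - \<tau>)) (noise t)"
    "AE \<omega> in M. w t \<omega> = w0 0 - (LBINT s:{0..t}. w (s - \<tau>) \<omega>) + \<sigma> * noise t \<omega>"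
proof -
  have "\<exists>I. has_ito_integral M F B t (\<lambda>s. w (s - \<tau>)) I \<and>
     (AE \<omega> in M. w t \<omega> = w0 0 - (LBINT s:{0..t}. w (s - \<tau>) \<omega>) + \<sigma> * I \<omega>)"
    using solution assms unfolding sdde_solution_def by blast
  from someI_ex[OF this] show "has_ito_integral M F B t (\<lambda>s. w (s - \<tau>)) (noise t)"
    "AE \<omega> in M. w t \<omega> = w0 0 - (LBINT s:{0..t}. w (s - \<tau>) \<omega>) + \<sigma> * noise t \<omega>"
    unfolding noise_def[symmetric] by auto
qed

lemma W_pair_measurable [measurable]: "(\<lambda>p. W (fst p) (snd p)) \<in> borel_measurable (lborel \<Otimes>\<^sub>M M)"
proof -
  have wm: "(\<lambda>(t, \<omega>). w t \<omega>) \<in> borel_measurable (restrict_space borel {-\<tau>..} \<Otimes>\<^sub>M M)"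
    using solution by (simp add: sdde_solution_def)
  have "(\<lambda>p. max (-\<tau>) (fst p)) \<in> lborel \<Otimes>\<^sub>M M \<rightarrow>\<^sub>M restrict_space borel {-\<tau>..}"
    by (intro measurable_restrict_space2) auto
  then have "(\<lambda>p. (max (-\<tau>) (fst p), snd p)) \<in> lborel \<Otimes>\<^sub>M M \<rightarrow>\<^sub>M restrict_space borel {-\<tau>..} \<Otimes>\<^sub>M M"
    by (intro measurable_Pair) auto
  from measurable_compose[OF this wm]
  have "(\<lambda>p. indicator {-\<tau>..} (fst p) * w (max (-\<tau>) (fst p)) (snd p)) \<in> borel_measurable (lborel \<Otimes>\<^sub>M M)"
    by simp
  also have "(\<lambda>p. indicator {-\<tau>..} (fst p) * w (max (-\<tau>) (fst p)) (snd p)) = (\<lambda>p. W (fst p) (snd p))"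
    by (auto simp: W_def fun_eq_iff indicator_def max_def)
  finally show ?thesis .
qed

lemma W_measurable_compose [measurable (raw)]:
  assumes "f \<in> N \<rightarrow>\<^sub>M borel" "g \<in> N \<rightarrow>\<^sub>M M"
  shows "(\<lambda>x. W (f x) (g x)) \<in> borel_measurable N"
proof -
  have "(\<lambda>x. (f x, g x)) \<in> N \<rightarrow>\<^sub>M lborel \<Otimes>\<^sub>M M" using assms by simp
  from measurable_compose[OF this W_pair_measurable] show ?thesis by simp
qed

lemma W_adapted: "r \<le> s \<Longrightarrow> W r \<in> borel_measurable (F s)"
proof -
  assume "r \<le> s"
  have "W r \<in> borel_measurable (F r)"
  proof (cases "-\<tau> \<le> r")
    case True
    then have "w r \<in> borel_measurable (F r)" using solution by (simp add: sdde_solution_def)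
    then show ?thesis using True by (simp add: W_def[abs_def])
  qed (simp add: W_def[abs_def])
  then show ?thesis using \<open>r \<le> s\<close> by (rule measurable_F_mono)
qed

lemma square_integrable_W_Iic:
  "square_integrable (lborel \<Otimes>\<^sub>M M) (\<lambda>p. indicator {..T} (fst p) * W (fst p) (snd p))"
  unfolding square_integrable_iff_nn
proof
  let ?f = "\<lambda>p. indicator {..T} (fst p) * W (fst p) (snd p)"
  show fm: "?f \<in> borel_measurable (lborel \<Otimes>\<^sub>M M)" by measurable
  have "(\<integral>\<^sup>+p. ennreal ((?f p)\<^sup>2) \<partial>(lborel \<Otimes>\<^sub>M M)) = (\<integral>\<^sup>+\<omega>. (\<integral>\<^sup>+r. ennreal ((?f (r, \<omega>))\<^sup>2) \<partial>lborel) \<partial>M)"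
    by (rule P.nn_integral_snd[symmetric]) (use fm in measurable)
  also have "\<dots> = (\<integral>\<^sup>+\<omega>. (\<integral>\<^sup>+t\<in>{-\<tau>..T}. ennreal ((w t \<omega>)\<^sup>2) \<partial>lborel) \<partial>M)"
    by (intro nn_integral_cong) (auto simp: indicator_def W_def)
  also have "\<dots> < \<infinity>" using solution by (auto simp: sdde_solution_def)
  finally show "(\<integral>\<^sup>+p. ennreal ((?f p)\<^sup>2) \<partial>(lborel \<Otimes>\<^sub>M M)) < \<infinity>" .
qed

lemma square_integrable_W_Ioc:
  "square_integrable (lborel \<Otimes>\<^sub>M M) (\<lambda>p. indicator {a<..b} (fst p) * W (fst p) (snd p))"
proof -
  have "square_integrable (lborel \<Otimes>\<^sub>M M)
      (\<lambda>p. indicator {a<..b} (fst p) * (indicator {..b} (fst p) * W (fst p) (snd p)))"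
    by (rule square_integrable_bounded_mult[OF square_integrable_W_Iic, of _ 1]) (auto simp: indicator_def)
  also have "(\<lambda>p. indicator {a<..b} (fst p) * (indicator {..b} (fst p) * W (fst p) (snd p))) =
      (\<lambda>p. indicator {a<..b} (fst p) * W (fst p) (snd p))"
    by (auto simp: indicator_def)
  finally show ?thesis .
qed

lemma second_moment_nonneg: "0 \<le> second_moment r"
  by (simp add: second_moment_def)

lemma second_moment_integrable: "integrable lborel (\<lambda>r. indicator {a<..b} r * second_moment r)"
proof -
  have "integrable lborel (\<lambda>r. \<integral>\<omega>. (indicator {a<..b} r * W r \<omega>)\<^sup>2 \<partial>M)"
    using P.integrable_fst'[OF square_integrableD[OF square_integrable_W_Ioc[of a b]]] by simp
  also have "(\<lambda>r. \<integral>\<omega>. (indicator {a<..b} r * W r \<omega>)\<^sup>2 \<partial>M) = (\<lambda>r. indicator {a<..b} r * second_moment r)"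
    by (auto simp: second_moment_def indicator_def)
  finally show ?thesis .
qed

lemma integral_W_square:
  "(\<integral>p. (indicator {a<..b} (fst p) * W (fst p) (snd p))\<^sup>2 \<partial>(lborel \<Otimes>\<^sub>M M)) = energy a b"
proof -
  have "(\<integral>p. (indicator {a<..b} (fst p) * W (fst p) (snd p))\<^sup>2 \<partial>(lborel \<Otimes>\<^sub>M M)) =
      (\<integral>r. (\<integral>\<omega>. (indicator {a<..b} r * W r \<omega>)\<^sup>2 \<partial>M) \<partial>lborel)"
    using P.integral_fst'[OF square_integrableD[OF square_integrable_W_Ioc[of a b]]] by simp
  also have "\<dots> = energy a b"
    unfolding energy_def second_moment_def by (intro Bochner_Integration.integral_cong) (auto simp: indicator_def)
  finally show ?thesis .
qed

lemma energy_nonneg: "0 \<le> energy a b"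
  unfolding energy_def by (simp add: second_moment_nonneg)

lemma energy_mono: "a' \<le> a \<Longrightarrow> b \<le> b' \<Longrightarrow> energy a b \<le> energy a' b'"
  unfolding energy_def
  by (intro integral_mono second_moment_integrable) (auto simp: indicator_def second_moment_nonneg)

lemma energy_split: "a \<le> b \<Longrightarrow> b \<le> c \<Longrightarrow> energy a c = energy a b + energy b c"
  unfolding energy_def Bochner_Integration.integral_add[OF second_moment_integrable second_moment_integrable, symmetric]
  by (intro Bochner_Integration.integral_cong) (auto simp: indicator_def)

lemma AE_path_square_integrable:
  "AE \<omega> in M. square_integrable lborel (\<lambda>r. indicator {a<..b} r * W r \<omega>)"
proof -
  have "integrable (lborel \<Otimes>\<^sub>M M) (\<lambda>(r, \<omega>). (indicator {a<..b} r * W r \<omega>)\<^sup>2)"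
    using square_integrableD[OF square_integrable_W_Ioc[of a b]] by (simp add: case_prod_unfold)
  from P.AE_integrable_snd[OF this] AE_space show ?thesis
    by eventually_elim (auto simp: square_integrable_def)
qed

lemma AE_path_integrable: "AE \<omega> in M. integrable lborel (\<lambda>r. indicator {a<..b} r * W r \<omega>)"
  using AE_path_square_integrable[of a b]
proof eventually_elim
  case (elim \<omega>)
  have "integrable lborel (\<lambda>r. indicator {a<..b} r * (indicator {a<..b} r * W r \<omega>))"
    by (rule square_integrable_mult[OF square_integrable_indicator_Ioc elim])
  then show ?case by (simp add: mult.assoc[symmetric] indicator_inter_arith[symmetric])
qed

lemma path_integral_split:
  assumes "a \<le> b" "b \<le> c"
  shows "AE \<omega> in M. path_integral a c \<omega> = path_integral a b \<omega> + path_integral b c \<omega>"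
  using AE_path_integrable[of a b] AE_path_integrable[of b c]
proof eventually_elim
  case (elim \<omega>)
  have "path_integral a c \<omega> = (\<integral>r. indicator {a<..b} r * W r \<omega> + indicator {b<..c} r * W r \<omega> \<partial>lborel)"
    unfolding path_integral_def using assms
    by (intro Bochner_Integration.integral_cong) (auto simp: indicator_def)
  then show ?case unfolding path_integral_def using elim by simp
qed

lemma path_integral_measurable [measurable]: "path_integral a b \<in> borel_measurable M"
  unfolding path_integral_def by measurable

lemma path_integral_square:
  assumes "a \<le> b"
  shows "square_integrable M (path_integral a b)"
    "(\<integral>\<omega>. (path_integral a b \<omega>)\<^sup>2 \<partial>M) \<le> (b - a) * energy a b"
proof -
  let ?q = "\<lambda>\<omega>. \<integral>r. (indicator {a<..b} r * W r \<omega>)\<^sup>2 \<partial>lborel"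
  have *: "integrable (lborel \<Otimes>\<^sub>M M) (\<lambda>(r, \<omega>). (indicator {a<..b} r * W r \<omega>)\<^sup>2)"
    using square_integrableD[OF square_integrable_W_Ioc[of a b]] by (simp add: case_prod_unfold)
  have q: "integrable M ?q" using P.integrable_snd[OF *] .
  have le: "AE \<omega> in M. (path_integral a b \<omega>)\<^sup>2 \<le> (b - a) * ?q \<omega>"
    using AE_path_square_integrable[of a b]
  proof eventually_elim
    case (elim \<omega>)
    \<comment> \<open>Doubling the indicator exhibits the path integral as an inner product with an
      indicator of squared norm \<open>b - a\<close>.\<close>
    have "path_integral a b \<omega> = (\<integral>r. indicator {a<..b} r * (indicator {a<..b} r * W r \<omega>) \<partial>lborel)"
      unfolding path_integral_def by (simp add: mult.assoc[symmetric] indicator_inter_arith[symmetric])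
    moreover have "(\<integral>r. (indicator {a<..b} r :: real)\<^sup>2 \<partial>lborel) = b - a"
      using assms by (simp add: power2_eq_square indicator_inter_arith[symmetric])
    ultimately show ?case
      using Cauchy_Schwarz_integral[OF square_integrable_indicator_Ioc[of a b] elim] by simp
  qed
  show si: "square_integrable M (path_integral a b)"
    unfolding square_integrable_def
  proof
    show "integrable M (\<lambda>\<omega>. (path_integral a b \<omega>)\<^sup>2)"
    proof (rule Bochner_Integration.integrable_bound)
      show "integrable M (\<lambda>\<omega>. (b - a) * ?q \<omega>)" using q by simp
      show "AE \<omega> in M. norm ((path_integral a b \<omega>)\<^sup>2) \<le> norm ((b - a) * ?q \<omega>)"
        using le by eventually_elim simp
    qed measurable
  qed measurable
  have "(\<integral>\<omega>. (path_integral a b \<omega>)\<^sup>2 \<partial>M) \<le> (\<integral>\<omega>. (b - a) * ?q \<omega> \<partial>M)"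
    by (rule integral_mono_AE[OF square_integrableD[OF si] _ le]) (use q in simp)
  also have "\<dots> = (b - a) * (\<integral>p. (indicator {a<..b} (fst p) * W (fst p) (snd p))\<^sup>2 \<partial>(lborel \<Otimes>\<^sub>M M))"
    using P.integral_snd[OF *] by (simp add: case_prod_unfold)
  finally show "(\<integral>\<omega>. (path_integral a b \<omega>)\<^sup>2 \<partial>M) \<le> (b - a) * energy a b"
    unfolding integral_W_square .
qed

lemma path_integral_Fubini:
  assumes X: "square_integrable M X"
  shows "(\<integral>\<omega>. X \<omega> * path_integral a b \<omega> \<partial>M) = (\<integral>r. indicator {a<..b} r * (\<integral>\<omega>. X \<omega> * W r \<omega> \<partial>M) \<partial>lborel)"
    "integrable lborel (\<lambda>r. indicator {a<..b} r * (\<integral>\<omega>. X \<omega> * W r \<omega> \<partial>M))"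
proof -
  \<comment> \<open>Giving each factor its own copy of the indicator makes both square integrable on
    the product space.\<close>
  have "integrable (lborel \<Otimes>\<^sub>M M) (\<lambda>p. (indicator {a<..b} (fst p) * X (snd p)) *
      (indicator {a<..b} (fst p) * W (fst p) (snd p)))"
    by (rule square_integrable_mult[OF P.square_integrable_fst_mult_snd[OF square_integrable_indicator_Ioc X]
          square_integrable_W_Ioc])
  also have "(\<lambda>p. (indicator {a<..b} (fst p) * X (snd p)) *
      (indicator {a<..b} (fst p) * W (fst p) (snd p))) = (\<lambda>(r, \<omega>). X \<omega> * (indicator {a<..b} r * W r \<omega>))"
    by (auto simp: indicator_def)
  finally have i: "integrable (lborel \<Otimes>\<^sub>M M) (\<lambda>(r, \<omega>). X \<omega> * (indicator {a<..b} r * W r \<omega>))" .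
  have e: "(\<integral>\<omega>. X \<omega> * (indicator {a<..b} r * W r \<omega>) \<partial>M) = indicator {a<..b} r * (\<integral>\<omega>. X \<omega> * W r \<omega> \<partial>M)" for r
    by (simp add: indicator_def)
  show "integrable lborel (\<lambda>r. indicator {a<..b} r * (\<integral>\<omega>. X \<omega> * W r \<omega> \<partial>M))"
    using P.integrable_fst[OF i] unfolding e .
  show "(\<integral>\<omega>. X \<omega> * path_integral a b \<omega> \<partial>M) = (\<integral>r. indicator {a<..b} r * (\<integral>\<omega>. X \<omega> * W r \<omega> \<partial>M) \<partial>lborel)"
    using P.Fubini_integral[OF i] unfolding e by (simp add: path_integral_def)
qed

section \<open>The noise term and the equation at a fixed time\<close>

lemma noise_stochastic_integral:
  assumes "0 \<le> t"
  shows "stochastic_integral (\<lambda>p. indicator {0<..t} (fst p) * W (fst p - \<tau>) (snd p)) (noise t)"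
proof -
  have "(\<lambda>p. indicator {0<..t} (fst p) * w (fst p - \<tau>) (snd p)) =
      (\<lambda>p. indicator {0<..t} (fst p) * W (fst p - \<tau>) (snd p))"
    by (auto simp: W_def indicator_def)
  with has_ito_integral_stochastic_integral[OF noise(1)[OF assms] assms] show ?thesis by simp
qed

lemma noise_diff_stochastic_integral:
  assumes "0 \<le> s" "s \<le> t"
  shows "stochastic_integral (\<lambda>p. indicator {s<..t} (fst p) * W (fst p - \<tau>) (snd p)) (\<lambda>\<omega>. noise t \<omega> - noise s \<omega>)"
proof -
  have "(\<lambda>p. indicator {0<..t} (fst p) * W (fst p - \<tau>) (snd p) - indicator {0<..s} (fst p) * W (fst p - \<tau>) (snd p)) =
      (\<lambda>p. indicator {s<..t} (fst p) * W (fst p - \<tau>) (snd p))"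
    using assms by (auto simp: indicator_def fun_eq_iff)
  with stochastic_integral_diff[OF noise_stochastic_integral noise_stochastic_integral, of t s] assms
  show ?thesis by simp
qed

lemma noise_square_integrable: "0 \<le> t \<Longrightarrow> square_integrable M (noise t)"
  by (rule stochastic_integral_square_integrable[OF noise_stochastic_integral])

lemma integral_shifted_square:
  assumes "stochastic_integral (\<lambda>p. indicator {s<..t} (fst p) * W (fst p - \<tau>) (snd p)) X"
  shows "(\<integral>\<omega>. (X \<omega>)\<^sup>2 \<partial>M) = energy (s - \<tau>) (t - \<tau>)"
proof -
  let ?f = "\<lambda>p. indicator {s<..t} (fst p) * W (fst p - \<tau>) (snd p)"
  have "(\<integral>\<omega>. (X \<omega>)\<^sup>2 \<partial>M) = (\<integral>p. (?f p)\<^sup>2 \<partial>(lborel \<Otimes>\<^sub>M M))"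
    by (rule stochastic_integral_isometry[OF assms])
  also have "\<dots> = (\<integral>r. (\<integral>\<omega>. (indicator {s<..t} r * W (r - \<tau>) \<omega>)\<^sup>2 \<partial>M) \<partial>lborel)"
    using P.integral_fst'[OF square_integrableD[OF stochastic_integral_square_integrable(1)[OF assms]]] by simp
  also have "\<dots> = (\<integral>r. indicator {s<..t} r * second_moment (r - \<tau>) \<partial>lborel)"
    unfolding second_moment_def by (intro Bochner_Integration.integral_cong) (auto simp: indicator_def)
  also have "\<dots> = (\<integral>r. indicator {s<..t} (\<tau> + r) * second_moment r \<partial>lborel)"
    using lborel_integral_real_affine[of 1 "\<lambda>r. indicator {s<..t} r * second_moment (r - \<tau>)" \<tau>] by simp
  also have "\<dots> = energy (s - \<tau>) (t - \<tau>)"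
    unfolding energy_def by (intro Bochner_Integration.integral_cong) (auto simp: indicator_def)
  finally show ?thesis .
qed

lemma W_eq:
  assumes "0 \<le> t"
  shows "AE \<omega> in M. W t \<omega> = w0 0 - path_integral (-\<tau>) (t - \<tau>) \<omega> + \<sigma> * noise t \<omega>"
proof -
  have eq: "(LBINT s:{0..t}. w (s - \<tau>) \<omega>) = path_integral (-\<tau>) (t - \<tau>) \<omega>" if "\<omega> \<in> space M" for \<omega>
  proof -
    have "(LBINT s:{0..t}. w (s - \<tau>) \<omega>) = (\<integral>s. indicator {0..t} s * W (s - \<tau>) \<omega> \<partial>lborel)"
      unfolding set_lebesgue_integral_def
      by (intro Bochner_Integration.integral_cong) (auto simp: indicator_def W_def)
    also have "\<dots> = (\<integral>r. indicator {0..t} (\<tau> + r) * W r \<omega> \<partial>lborel)"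
      using lborel_integral_real_affine[of 1 "\<lambda>s. indicator {0..t} s * W (s - \<tau>) \<omega>" \<tau>] by simp
    also have "\<dots> = path_integral (-\<tau>) (t - \<tau>) \<omega>"
      unfolding path_integral_def
    proof (rule integral_cong_AE)
      \<comment> \<open>Shifted by the delay, the closed interval \<open>{0..t}\<close> contains its
        left endpoint \<open>-\<tau>\<close>, which the half-open one omits: a null set.\<close>
      show "AE r in lborel. indicator {0..t} (\<tau> + r) * W r \<omega> = indicator {-\<tau><..t - \<tau>} r * W r \<omega>"
        using AE_lborel_singleton[of "-\<tau>"] by eventually_elim (auto simp: indicator_def)
    qed (use that in measurable)
    finally show ?thesis .
  qed
  show ?thesis
    using noise(2)[OF assms] AE_space
  proof eventually_elim
    case (elim \<omega>)
    then show ?case using assms \<tau>_pos eq[of \<omega>] by (simp add: W_def)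
  qed
qed

text \<open>\<open>sdde_solution\<close> bounds second moments only after integration in time. At a
  fixed time the bound comes from the equation itself if \<open>r\<close> is nonnegative, and
  otherwise from the deterministic initial datum or the extension by zero.\<close>

lemma W_square_integrable: "square_integrable M (W r)"
proof (cases "0 \<le> r")
  case True
  have "square_integrable M (\<lambda>\<omega>. w0 0 - path_integral (-\<tau>) (r - \<tau>) \<omega> + \<sigma> * noise r \<omega>)"
    using True by (intro square_integrable_add square_integrable_diff square_integrable_const
        square_integrable_cmult path_integral_square(1) noise_square_integrable) simp_all
  from square_integrable_cong_AE[OF this _ W_eq[OF True]] show ?thesis by measurable
next
  case False
  have "AE \<omega> in M. W r \<omega> = (if -\<tau> \<le> r then w0 r else 0)"
  proof (cases "-\<tau> \<le> r")
    case True
    then have "AE \<omega> in M. w r \<omega> = w0 r" using solution False by (simp add: sdde_solution_def)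
    then show ?thesis using True by (simp add: W_def)
  qed (simp add: W_def)
  from square_integrable_cong_AE[OF square_integrable_const _ this] show ?thesis by measurable
qed

text \<open>The noise gained after \<open>max 0 r\<close> is the stochastic integral of an integrand
  that vanishes up to that time, hence orthogonal to \<open>W r\<close>. For negative
  \<open>r\<close> the maximum selects time 0, where the noise starts.\<close>

lemma noise_martingale:
  assumes "r \<le> t" "0 \<le> t"
  shows "(\<integral>\<omega>. W r \<omega> * noise t \<omega> \<partial>M) = (\<integral>\<omega>. W r \<omega> * noise (max 0 r) \<omega> \<partial>M)"
proof -
  have "(\<integral>\<omega>. W r \<omega> * (noise t \<omega> - noise (max 0 r) \<omega>) \<partial>M) = 0"
    using assms by (intro stochastic_integral_orthogonal[where s = "max 0 r",
          OF noise_diff_stochastic_integral[of "max 0 r" t]])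
      (auto simp: W_square_integrable W_adapted indicator_def)
  then show ?thesis
    using square_integrable_mult[OF W_square_integrable noise_square_integrable, of t r]
      square_integrable_mult[OF W_square_integrable noise_square_integrable, of "max 0 r" r] assms
    by (simp add: right_diff_distrib)
qed

lemma noise_mean: "0 \<le> t \<Longrightarrow> (\<integral>\<omega>. noise t \<omega> \<partial>M) = 0"
  using stochastic_integral_orthogonal[OF noise_stochastic_integral, of t 0 "\<lambda>_. 1"] by simp

lemma covariance_bound: "\<bar>\<integral>\<omega>. W r \<omega> * W q \<omega> \<partial>M\<bar> \<le> (second_moment r + second_moment q) / 2"
proof -
  have i: "integrable M (\<lambda>\<omega>. ((W r \<omega>)\<^sup>2 + (W q \<omega>)\<^sup>2) / 2)"
    using square_integrableD[OF W_square_integrable] by simp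
  have "\<bar>\<integral>\<omega>. W r \<omega> * W q \<omega> \<partial>M\<bar> \<le> (\<integral>\<omega>. \<bar>W r \<omega> * W q \<omega>\<bar> \<partial>M)"
    by (rule integral_abs_bound)
  also have "\<dots> \<le> (\<integral>\<omega>. ((W r \<omega>)\<^sup>2 + (W q \<omega>)\<^sup>2) / 2 \<partial>M)"
  proof (rule integral_mono[OF _ i])
    show "integrable M (\<lambda>\<omega>. \<bar>W r \<omega> * W q \<omega>\<bar>)"
      by (intro integrable_abs square_integrable_mult W_square_integrable)
    fix \<omega>
    have "0 \<le> (\<bar>W r \<omega>\<bar> - \<bar>W q \<omega>\<bar>)\<^sup>2" by simp
    then show "\<bar>W r \<omega> * W q \<omega>\<bar> \<le> ((W r \<omega>)\<^sup>2 + (W q \<omega>)\<^sup>2) / 2"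
      unfolding power2_diff abs_mult power2_abs by simp
  qed
  also have "\<dots> = (second_moment r + second_moment q) / 2"
    using square_integrableD[OF W_square_integrable] by (simp add: second_moment_def)
  finally show ?thesis .
qed

section \<open>The mean square of the neutral process\<close>

lemma path_integral_double:
  assumes that: "a \<le> t"
  shows "(\<integral>\<omega>. (path_integral a t \<omega>)\<^sup>2 \<partial>M) =
      2 * (\<integral>r. indicator {a<..t} r * (\<integral>\<omega>. W r \<omega> * path_integral a r \<omega> \<partial>M) \<partial>lborel)"
    and "integrable lborel (\<lambda>r. indicator {a<..t} r * (\<integral>\<omega>. W r \<omega> * path_integral a r \<omega> \<partial>M))"
proof -
  define K where "K r q = (\<integral>\<omega>. W r \<omega> * W q \<omega> \<partial>M)" for r q
  define k where "k r q = indicator {a<..t} r * indicator {a<..t} q * K r q" for r q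
  have "(\<lambda>p. K (fst p) (snd p)) \<in> borel_measurable (lborel \<Otimes>\<^sub>M lborel)"
    unfolding K_def by measurable
  then have km: "(\<lambda>(r, q). k r q) \<in> borel_measurable (lborel \<Otimes>\<^sub>M lborel)"
    unfolding k_def case_prod_unfold by measurable
  have "integrable (lborel \<Otimes>\<^sub>M lborel) (\<lambda>(r, q). k r q)"
  proof (rule Bochner_Integration.integrable_bound[OF _ km])
    have 1: "integrable lborel (indicator {a<..t} :: real \<Rightarrow> real)" using that by simp
    \<comment> \<open>The covariance bound dominates the kernel by a sum whose terms each involve
      the second moment at only one of the two times.\<close>
    show "integrable (lborel \<Otimes>\<^sub>M lborel)
        (\<lambda>p. (indicator {a<..t} (fst p) * second_moment (fst p)) * indicator {a<..t} (snd p)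
           + indicator {a<..t} (fst p) * (indicator {a<..t} (snd p) * second_moment (snd p)))"
      by (rule Bochner_Integration.integrable_add[OF
          lborel_pair.integrable_fst_mult_snd[OF second_moment_integrable[of a t] 1]
          lborel_pair.integrable_fst_mult_snd[OF 1 second_moment_integrable[of a t]]])
    have "\<bar>K r q\<bar> \<le> second_moment r + second_moment q" for r q
      using covariance_bound[of r q] second_moment_nonneg[of r] second_moment_nonneg[of q] unfolding K_def by argo
    then show "AE p in lborel \<Otimes>\<^sub>M lborel. norm (case p of (r, q) \<Rightarrow> k r q) \<le>
      norm ((indicator {a<..t} (fst p) * second_moment (fst p)) * indicator {a<..t} (snd p)
           + indicator {a<..t} (fst p) * (indicator {a<..t} (snd p) * second_moment (snd p)))"
      using second_moment_nonneg by (intro AE_I2) (auto simp: k_def indicator_def)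
  qed
  moreover have "k r q = k q r" for r q
    by (simp add: k_def K_def mult_ac)
  ultimately have *: "(\<integral>r. (\<integral>q. k r q \<partial>lborel) \<partial>lborel) =
      2 * (\<integral>r. (\<integral>q. indicator {..r} q * k r q \<partial>lborel) \<partial>lborel)"
    "integrable lborel (\<lambda>r. \<integral>q. indicator {..r} q * k r q \<partial>lborel)"
    by (rule symmetric_double_integral)+
  have **: "(\<integral>q. indicator {..r} q * k r q \<partial>lborel) = indicator {a<..t} r * (\<integral>\<omega>. W r \<omega> * path_integral a r \<omega> \<partial>M)" for r
  proof (cases "r \<in> {a<..t}")
    case True
    then have "(\<integral>q. indicator {..r} q * k r q \<partial>lborel) = (\<integral>q. indicator {a<..r} q * K r q \<partial>lborel)"
      by (intro Bochner_Integration.integral_cong) (auto simp: k_def indicator_def)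
    also have "\<dots> = (\<integral>\<omega>. W r \<omega> * path_integral a r \<omega> \<partial>M)"
      unfolding K_def by (rule path_integral_Fubini(1)[OF W_square_integrable, symmetric])
    finally show ?thesis using True by simp
  qed (simp add: k_def)
  show "integrable lborel (\<lambda>r. indicator {a<..t} r * (\<integral>\<omega>. W r \<omega> * path_integral a r \<omega> \<partial>M))"
    using *(2) unfolding ** .
  have "(\<integral>\<omega>. (path_integral a t \<omega>)\<^sup>2 \<partial>M) =
      (\<integral>r. indicator {a<..t} r * (\<integral>\<omega>. path_integral a t \<omega> * W r \<omega> \<partial>M) \<partial>lborel)"
    using path_integral_Fubini(1)[OF path_integral_square(1)[OF that], of a t] by (simp add: power2_eq_square)
  also have "\<dots> = (\<integral>r. (\<integral>q. k r q \<partial>lborel) \<partial>lborel)"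
  proof (rule Bochner_Integration.integral_cong[OF refl])
    fix r
    have "(\<integral>\<omega>. path_integral a t \<omega> * W r \<omega> \<partial>M) = (\<integral>q. indicator {a<..t} q * K r q \<partial>lborel)"
      unfolding K_def path_integral_Fubini(1)[OF W_square_integrable, symmetric] by (simp add: mult.commute)
    then show "indicator {a<..t} r * (\<integral>\<omega>. path_integral a t \<omega> * W r \<omega> \<partial>M) = (\<integral>q. k r q \<partial>lborel)"
      by (simp add: k_def indicator_def)
  qed
  finally show "(\<integral>\<omega>. (path_integral a t \<omega>)\<^sup>2 \<partial>M) =
      2 * (\<integral>r. indicator {a<..t} r * (\<integral>\<omega>. W r \<omega> * path_integral a r \<omega> \<partial>M) \<partial>lborel)"
    unfolding *(1) ** .
qed

text \<open>For \<open>t \<ge> 0\<close> this is the process \<open>z\<close>; the equation makes its two descriptions agree almost surely.\<close>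

definition neutral :: "real \<Rightarrow> 'a \<Rightarrow> real" where
  "neutral t \<omega> = w0 0 - path_integral (-\<tau>) t \<omega> + \<sigma> * noise (max 0 t) \<omega>"

text \<open>Half the rate at which the drift \<open>-w\<close> lowers the mean square of
  \<open>neutral\<close>.\<close>

definition dissipation :: "real \<Rightarrow> real" where
  "dissipation r = (\<integral>\<omega>. W r \<omega> * neutral r \<omega> \<partial>M)"

lemma neutral_eq:
  assumes "0 \<le> t"
  shows "AE \<omega> in M. neutral t \<omega> = W t \<omega> - path_integral (t - \<tau>) t \<omega>"
proof -
  have "AE \<omega> in M. path_integral (-\<tau>) t \<omega> = path_integral (-\<tau>) (t - \<tau>) \<omega> + path_integral (t - \<tau>) t \<omega>"
    using assms \<tau>_pos by (intro path_integral_split) auto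
  with W_eq[OF assms] show ?thesis
    by eventually_elim (use assms in \<open>simp add: neutral_def\<close>)
qed

lemma dissipation_expand:
  assumes "-\<tau> \<le> r"
  shows "dissipation r = (w0 0 * (\<integral>\<omega>. W r \<omega> \<partial>M)) - (\<integral>\<omega>. W r \<omega> * path_integral (-\<tau>) r \<omega> \<partial>M)
    + \<sigma> * (\<integral>\<omega>. W r \<omega> * noise (max 0 r) \<omega> \<partial>M)"
proof -
  note i = square_integrable_imp_integrable[OF W_square_integrable[of r]]
    square_integrable_mult[OF W_square_integrable[of r] path_integral_square(1)[OF assms]]
    square_integrable_mult[OF W_square_integrable[of r] noise_square_integrable[of "max 0 r"]]
  have "dissipation r = (\<integral>\<omega>. w0 0 * W r \<omega> - W r \<omega> * path_integral (-\<tau>) r \<omega>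
      + \<sigma> * (W r \<omega> * noise (max 0 r) \<omega>) \<partial>M)"
    unfolding dissipation_def neutral_def
    by (intro Bochner_Integration.integral_cong) (auto simp: algebra_simps)
  then show ?thesis using i by simp
qed

text \<open>The time integral of \<open>dissipation\<close> starts at \<open>-\<tau>\<close> because
  the path integral in \<open>neutral\<close> does. Its part over the initial interval is a
  constant, separated off in \<open>energy_bounded\<close>.\<close>

lemma neutral_square:
  assumes t: "0 \<le> t"
  shows "(\<integral>\<omega>. (neutral t \<omega>)\<^sup>2 \<partial>M) =
      (w0 0)\<^sup>2 + \<sigma>\<^sup>2 * energy (-\<tau>) (t - \<tau>) - 2 * (\<integral>r. indicator {-\<tau><..t} r * dissipation r \<partial>lborel)"
    and "integrable lborel (\<lambda>r. indicator {-\<tau><..t} r * dissipation r)"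
proof -
  let ?c = "w0 0" and ?A = "path_integral (-\<tau>) t" and ?I = "noise t" and ?i = "indicator {-\<tau><..t} :: real \<Rightarrow> real"
  have tt: "-\<tau> \<le> t" using t \<tau>_pos by simp
  note A = path_integral_square(1)[OF tt] and I = noise_square_integrable[OF t]
  note i = square_integrableD[OF A] square_integrableD[OF I] square_integrable_imp_integrable[OF A]
    square_integrable_imp_integrable[OF I] square_integrable_mult[OF I A]
  have "(\<integral>\<omega>. (neutral t \<omega>)\<^sup>2 \<partial>M) = (\<integral>\<omega>. ?c\<^sup>2 + (?A \<omega>)\<^sup>2 + \<sigma>\<^sup>2 * (?I \<omega>)\<^sup>2 - 2 * ?c * ?A \<omega>
      - 2 * \<sigma> * (?I \<omega> * ?A \<omega>) + 2 * ?c * \<sigma> * ?I \<omega> \<partial>M)"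
    unfolding neutral_def using t
    by (intro Bochner_Integration.integral_cong) (auto simp: power2_eq_square algebra_simps)
  also have "\<dots> = ?c\<^sup>2 + (\<integral>\<omega>. (?A \<omega>)\<^sup>2 \<partial>M) + \<sigma>\<^sup>2 * (\<integral>\<omega>. (?I \<omega>)\<^sup>2 \<partial>M) - 2 * ?c * (\<integral>\<omega>. ?A \<omega> \<partial>M)
      - 2 * \<sigma> * (\<integral>\<omega>. ?I \<omega> * ?A \<omega> \<partial>M)"
    using i noise_mean[OF t] by (simp add: prob_space)
  finally have expand: "(\<integral>\<omega>. (neutral t \<omega>)\<^sup>2 \<partial>M) = \<dots>" .
  define a where "a r = ?i r * (\<integral>\<omega>. W r \<omega> \<partial>M)" for r
  define b where "b r = ?i r * (\<integral>\<omega>. W r \<omega> * path_integral (-\<tau>) r \<omega> \<partial>M)" for r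
  \<comment> \<open>Fubini leaves the noise at the final time \<open>t\<close> here. The martingale
    property moves it back to \<open>max 0 r\<close>, where it matches the noise in
    \<open>neutral r\<close>.\<close>
  define d where "d r = ?i r * (\<integral>\<omega>. ?I \<omega> * W r \<omega> \<partial>M)" for r
  have a: "(\<integral>\<omega>. ?A \<omega> \<partial>M) = (\<integral>r. a r \<partial>lborel)" "integrable lborel a"
    using path_integral_Fubini[of "\<lambda>_. 1" "-\<tau>" t] by (simp_all add: a_def[abs_def])
  have b: "(\<integral>\<omega>. (?A \<omega>)\<^sup>2 \<partial>M) = 2 * (\<integral>r. b r \<partial>lborel)" "integrable lborel b"
    using path_integral_double[OF tt] by (simp_all add: b_def[abs_def])
  have d: "(\<integral>\<omega>. ?I \<omega> * ?A \<omega> \<partial>M) = (\<integral>r. d r \<partial>lborel)" "integrable lborel d"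
    using path_integral_Fubini[OF I, of "-\<tau>" t] by (simp_all add: d_def[abs_def])
  have sum: "?i r * dissipation r = ?c * a r - b r + \<sigma> * d r" for r
  proof (cases "r \<in> {-\<tau><..t}")
    case True
    then have "(\<integral>\<omega>. ?I \<omega> * W r \<omega> \<partial>M) = (\<integral>\<omega>. W r \<omega> * noise (max 0 r) \<omega> \<partial>M)"
      using noise_martingale[of r t] t by (simp add: mult.commute)
    with True dissipation_expand[of r] show ?thesis by (simp add: a_def b_def d_def)
  qed (simp add: a_def b_def d_def)
  show "integrable lborel (\<lambda>r. ?i r * dissipation r)"
    unfolding sum using a b d by simp
  have "(\<integral>r. ?i r * dissipation r \<partial>lborel) = ?c * (\<integral>r. a r \<partial>lborel) - (\<integral>r. b r \<partial>lborel) + \<sigma> * (\<integral>r. d r \<partial>lborel)"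
    unfolding sum using a b d by simp
  moreover have "(\<integral>\<omega>. (?I \<omega>)\<^sup>2 \<partial>M) = energy (-\<tau>) (t - \<tau>)"
    using integral_shifted_square[OF noise_stochastic_integral[OF t]] by simp
  ultimately show "(\<integral>\<omega>. (neutral t \<omega>)\<^sup>2 \<partial>M) = ?c\<^sup>2 + \<sigma>\<^sup>2 * energy (-\<tau>) (t - \<tau>)
      - 2 * (\<integral>r. ?i r * dissipation r \<partial>lborel)"
    unfolding expand a(1) b(1) d(1) by (simp add: algebra_simps)
qed

section \<open>The energy estimate\<close>

text \<open>From time 0 on, \<open>neutral r\<close> is \<open>W r\<close> minus the integral over
  the last delay window, so memory enters through covariances of \<open>W r\<close> with that
  window. Each covariance is split evenly: the halves at \<open>r\<close> add up to \<tau> times the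
  present second moment, the halves in the window to its energy.\<close>

lemma dissipation_lower_bound:
  assumes "0 \<le> r"
  shows "second_moment r - (\<tau> * second_moment r + energy (r - \<tau>) r) / 2 \<le> dissipation r"
proof -
  have le: "r - \<tau> \<le> r" using \<tau>_pos by simp
  let ?i = "indicator {r - \<tau><..r} :: real \<Rightarrow> real"
  have 1: "integrable lborel ?i" "(\<integral>q. ?i q \<partial>lborel) = \<tau>" using le by auto
  note A = path_integral_square(1)[OF le]
  have "dissipation r = (\<integral>\<omega>. W r \<omega> * (W r \<omega> - path_integral (r - \<tau>) r \<omega>) \<partial>M)"
    unfolding dissipation_def
  proof (rule integral_cong_AE)
    show "AE \<omega> in M. W r \<omega> * neutral r \<omega> = W r \<omega> * (W r \<omega> - path_integral (r - \<tau>) r \<omega>)"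
      using neutral_eq[OF assms] by eventually_elim simp
    have [measurable]: "noise (max 0 r) \<in> borel_measurable M"
      by (rule square_integrable_measurable[OF noise_square_integrable]) simp
    show "(\<lambda>\<omega>. W r \<omega> * neutral r \<omega>) \<in> borel_measurable M" unfolding neutral_def by measurable
  qed measurable
  also have "\<dots> = second_moment r - (\<integral>\<omega>. W r \<omega> * path_integral (r - \<tau>) r \<omega> \<partial>M)"
    using square_integrableD[OF W_square_integrable[of r]] square_integrable_mult[OF W_square_integrable A]
    by (simp add: right_diff_distrib second_moment_def power2_eq_square)
  finally have eq: "dissipation r = second_moment r - (\<integral>\<omega>. W r \<omega> * path_integral (r - \<tau>) r \<omega> \<partial>M)" .
  have "(\<integral>\<omega>. W r \<omega> * path_integral (r - \<tau>) r \<omega> \<partial>M) = (\<integral>q. ?i q * (\<integral>\<omega>. W r \<omega> * W q \<omega> \<partial>M) \<partial>lborel)"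
    by (rule path_integral_Fubini(1)[OF W_square_integrable])
  also have "\<dots> \<le> (\<integral>q. (second_moment r * ?i q + ?i q * second_moment q) / 2 \<partial>lborel)"
  proof (rule integral_mono)
    show "integrable lborel (\<lambda>q. ?i q * (\<integral>\<omega>. W r \<omega> * W q \<omega> \<partial>M))"
      by (rule path_integral_Fubini(2)[OF W_square_integrable])
    show "integrable lborel (\<lambda>q. (second_moment r * ?i q + ?i q * second_moment q) / 2)"
      using second_moment_integrable[of "r - \<tau>" r] 1 by simp
    show "?i q * (\<integral>\<omega>. W r \<omega> * W q \<omega> \<partial>M) \<le> (second_moment r * ?i q + ?i q * second_moment q) / 2" for q
      using covariance_bound[of r q] by (auto simp: indicator_def)
  qed
  also have "\<dots> = (\<tau> * second_moment r + energy (r - \<tau>) r) / 2"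
    unfolding energy_def using second_moment_integrable[of "r - \<tau>" r] 1 by simp
  finally show ?thesis unfolding eq by simp
qed

text \<open>A time \<open>q\<close> lies in \<open>{r - \<tau><..r}\<close> exactly for
  \<open>r\<close> in \<open>{q..<q + \<tau>}\<close>, which has length \<tau>. Exchanging the
  integrals thus counts each second moment with weight at most \<tau>.\<close>

lemma delayed_energy:
  assumes "0 \<le> t"
  shows "integrable lborel (\<lambda>r. indicator {0<..t} r * energy (r - \<tau>) r)"
    and "(\<integral>r. indicator {0<..t} r * energy (r - \<tau>) r \<partial>lborel) \<le> \<tau> * energy (-\<tau>) t"
proof -
  define h :: "real \<Rightarrow> real \<Rightarrow> real" where
    "h r q = indicator {0<..t} r * (indicator {r - \<tau><..r} q * second_moment q)" for r q
  have mm: "(\<lambda>q. indicator {-\<tau><..t} q * second_moment q) \<in> borel_measurable lborel"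
    using second_moment_integrable by auto
  have "(\<lambda>p. indicator {0<..t} (fst p) * (if fst p - \<tau> < snd p \<and> snd p \<le> fst p then 1 else 0)
      * (indicator {-\<tau><..t} (snd p) * second_moment (snd p))) \<in> borel_measurable (lborel \<Otimes>\<^sub>M lborel)"
    using measurable_compose[OF measurable_snd mm] by measurable
  also have "(\<lambda>p. indicator {0<..t} (fst p) * (if fst p - \<tau> < snd p \<and> snd p \<le> fst p then 1 else 0)
      * (indicator {-\<tau><..t} (snd p) * second_moment (snd p))) = (\<lambda>(r, q). h r q)"
    by (auto simp: h_def indicator_def fun_eq_iff)
  finally have hm: "(\<lambda>(r, q). h r q) \<in> borel_measurable (lborel \<Otimes>\<^sub>M lborel)" .
  have i: "integrable (lborel \<Otimes>\<^sub>M lborel) (\<lambda>(r, q). h r q)"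
  proof (rule Bochner_Integration.integrable_bound[OF _ hm])
    show "integrable (lborel \<Otimes>\<^sub>M lborel) (\<lambda>p. indicator {0<..t} (fst p) * (indicator {-\<tau><..t} (snd p) * second_moment (snd p)))"
      by (rule lborel_pair.integrable_fst_mult_snd[OF _ second_moment_integrable]) (use assms in simp)
    show "AE p in lborel \<Otimes>\<^sub>M lborel. norm (case p of (r, q) \<Rightarrow> h r q) \<le>
        norm (indicator {0<..t} (fst p) * (indicator {-\<tau><..t} (snd p) * second_moment (snd p)))"
      using second_moment_nonneg by (intro AE_I2) (auto simp: h_def indicator_def)
  qed
  have e: "(\<integral>q. h r q \<partial>lborel) = indicator {0<..t} r * energy (r - \<tau>) r" for r
    by (simp add: h_def energy_def)
  show "integrable lborel (\<lambda>r. indicator {0<..t} r * energy (r - \<tau>) r)"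
    using lborel_pair.integrable_fst[OF i] unfolding e .
  have "(\<integral>r. indicator {0<..t} r * energy (r - \<tau>) r \<partial>lborel) = (\<integral>q. (\<integral>r. h r q \<partial>lborel) \<partial>lborel)"
    using lborel_pair.Fubini_integral[OF i] unfolding e by simp
  also have "\<dots> \<le> (\<integral>q. \<tau> * (indicator {-\<tau><..t} q * second_moment q) \<partial>lborel)"
  proof (rule integral_mono)
    show "integrable lborel (\<lambda>q. \<integral>r. h r q \<partial>lborel)" by (rule lborel_pair.integrable_snd[OF i])
    show "integrable lborel (\<lambda>q. \<tau> * (indicator {-\<tau><..t} q * second_moment q))" using second_moment_integrable by simp
    fix q
    have ico: "integrable lborel (indicator {q..<q + \<tau>} :: real \<Rightarrow> real)"
      "(\<integral>r. indicator {q..<q + \<tau>} r \<partial>lborel) = \<tau>" using \<tau>_pos by auto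
    have hq: "h r q = (indicator {0<..t} r * indicator {q..<q + \<tau>} r) * (indicator {-\<tau><..t} q * second_moment q)" for r
      by (auto simp: h_def indicator_def)
    have "(\<integral>r. indicator {0<..t} r * indicator {q..<q + \<tau>} r \<partial>lborel) \<le> (\<integral>r. (indicator {q..<q + \<tau>} r :: real) \<partial>lborel)"
    proof (rule integral_mono[OF _ ico(1)])
      show "integrable lborel (\<lambda>r. indicator {0<..t} r * indicator {q..<q + \<tau>} r :: real)"
        by (rule Bochner_Integration.integrable_bound[OF ico(1)]) (auto simp: indicator_def)
    qed (auto simp: indicator_def)
    then have "(\<integral>r. h r q \<partial>lborel) \<le> \<tau> * (indicator {-\<tau><..t} q * second_moment q)"
      unfolding hq using ico(2) second_moment_nonneg[of q] by (auto intro: mult_right_mono)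
    then show "(\<integral>r. h r q \<partial>lborel) \<le> \<tau> * (indicator {-\<tau><..t} q * second_moment q)" .
  qed
  also have "\<dots> = \<tau> * energy (-\<tau>) t" by (simp add: energy_def)
  finally show "(\<integral>r. indicator {0<..t} r * energy (r - \<tau>) r \<partial>lborel) \<le> \<tau> * energy (-\<tau>) t" .
qed

lemma energy_bounded:
  assumes small: "2 * \<tau> + \<sigma>\<^sup>2 < 2"
  obtains C where "\<And>t. 0 \<le> t \<Longrightarrow> energy 0 t \<le> C"
proof
  fix t :: real assume t: "0 \<le> t"
  \<comment> \<open>\<open>dissipation_lower_bound\<close> starts at time 0; the contribution of the
    initial interval is kept as a constant, which does not depend on \<open>t\<close>.\<close>
  define G where "G = (\<integral>r. indicator {-\<tau><..0} r * dissipation r \<partial>lborel)"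
  let ?i = "indicator {0<..t} :: real \<Rightarrow> real"
  have i0: "integrable lborel (\<lambda>r. indicator {-\<tau><..0} r * dissipation r)"
    using neutral_square(2)[of 0] by simp
  have it: "integrable lborel (\<lambda>r. indicator {-\<tau><..t} r * dissipation r)"
    by (rule neutral_square(2)[OF t])
  have split: "?i r * dissipation r = indicator {-\<tau><..t} r * dissipation r - indicator {-\<tau><..0} r * dissipation r" for r
    using t \<tau>_pos by (auto simp: indicator_def)
  have ip: "integrable lborel (\<lambda>r. ?i r * dissipation r)"
    unfolding split using i0 it by simp
  have sum: "(\<integral>r. indicator {-\<tau><..t} r * dissipation r \<partial>lborel) = G + (\<integral>r. ?i r * dissipation r \<partial>lborel)"
    unfolding split G_def using i0 it by simp
  have "energy 0 t - (\<tau> * energy 0 t + (\<integral>r. ?i r * energy (r - \<tau>) r \<partial>lborel)) / 2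
      = (\<integral>r. ?i r * second_moment r - (\<tau> * (?i r * second_moment r) + ?i r * energy (r - \<tau>) r) / 2 \<partial>lborel)"
    unfolding energy_def[of 0 t] using second_moment_integrable[of 0 t] delayed_energy(1)[OF t] by simp
  also have "\<dots> \<le> (\<integral>r. ?i r * dissipation r \<partial>lborel)"
  proof (rule integral_mono[OF _ ip])
    show "integrable lborel (\<lambda>r. ?i r * second_moment r - (\<tau> * (?i r * second_moment r) + ?i r * energy (r - \<tau>) r) / 2)"
      using second_moment_integrable[of 0 t] delayed_energy(1)[OF t] by simp
    show "?i r * second_moment r - (\<tau> * (?i r * second_moment r) + ?i r * energy (r - \<tau>) r) / 2 \<le> ?i r * dissipation r" for r
      using dissipation_lower_bound[of r] by (auto simp: indicator_def)
  qed
  finally have D: "energy 0 t - (\<tau> * energy 0 t + (\<integral>r. ?i r * energy (r - \<tau>) r \<partial>lborel)) / 2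
      \<le> (\<integral>r. ?i r * dissipation r \<partial>lborel)" .
  have e: "energy (-\<tau>) t = energy (-\<tau>) 0 + energy 0 t"
    using t \<tau>_pos by (intro energy_split) auto
  have "energy (-\<tau>) (t - \<tau>) \<le> energy (-\<tau>) 0 + energy 0 t"
    unfolding e[symmetric] using \<tau>_pos by (intro energy_mono) auto
  from mult_left_mono[OF this, of "\<sigma>\<^sup>2"]
  have s: "\<sigma>\<^sup>2 * energy (-\<tau>) (t - \<tau>) \<le> \<sigma>\<^sup>2 * energy (-\<tau>) 0 + \<sigma>\<^sup>2 * energy 0 t"
    by (simp add: distrib_left)
  have X: "(\<integral>r. ?i r * energy (r - \<tau>) r \<partial>lborel) \<le> \<tau> * energy (-\<tau>) 0 + \<tau> * energy 0 t"
    using delayed_energy(2)[OF t] unfolding e by (simp add: distrib_left)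
  have N: "0 \<le> (w0 0)\<^sup>2 + \<sigma>\<^sup>2 * energy (-\<tau>) (t - \<tau>) - 2 * (G + (\<integral>r. ?i r * dissipation r \<partial>lborel))"
    unfolding sum[symmetric] neutral_square(1)[OF t, symmetric] by simp
  \<comment> \<open>Twice the first inequality added to the last one cancels \<open>d\<close>; the
    two middle ones then replace \<open>q\<close> and \<open>x\<close>.\<close>
  have "2 * e - p \<le> c + r + y - 2 * g"
    if "e - (p + x) / 2 \<le> d" "q \<le> r" "x \<le> y" "0 \<le> c + q - 2 * (g + d)" for e p x d q r y c g :: real
    using that by argo
  from this[OF D s X N] have "(2 - 2 * \<tau> - \<sigma>\<^sup>2) * energy 0 t \<le> (w0 0)\<^sup>2 - 2 * G + (\<sigma>\<^sup>2 + \<tau>) * energy (-\<tau>) 0"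
    by (simp add: algebra_simps)
  then show "energy 0 t \<le> ((w0 0)\<^sup>2 - 2 * G + (\<sigma>\<^sup>2 + \<tau>) * energy (-\<tau>) 0) / (2 - 2 * \<tau> - \<sigma>\<^sup>2)"
    using small by (simp add: pos_le_divide_eq mult.commute)
qed

section \<open>Decay of the second moment\<close>

text \<open>Subtracting the equation at \<open>s\<close> from that at \<open>t\<close> leaves a path
  integral and a noise increment over the same delayed window. Cauchy-Schwarz gives the factor
  \<open>t - s\<close>, the isometry the factor \<open>\<sigma>^2\<close>.\<close>

lemma second_moment_increment:
  assumes "0 \<le> s" "s \<le> t"
  shows "second_moment t \<le> 2 * second_moment s + (4 * (t - s) + 4 * \<sigma>\<^sup>2) * energy (s - \<tau>) (t - \<tau>)"
proof -
  have le: "s - \<tau> \<le> t - \<tau>" using assms by simp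
  let ?A = "path_integral (s - \<tau>) (t - \<tau>)" and ?N = "\<lambda>\<omega>. noise t \<omega> - noise s \<omega>"
  note N = noise_diff_stochastic_integral[OF assms]
  have sq: "(a - x + y)\<^sup>2 \<le> 2 * a\<^sup>2 + 4 * x\<^sup>2 + 4 * y\<^sup>2" for a x y :: real
  proof -
    \<comment> \<open>The constants come from applying
      \<open>(p + q)^2 \<le> 2 * p^2 + 2 * q^2\<close> first to \<open>a\<close> and
      \<open>y - x\<close>, then to \<open>y\<close> and \<open>- x\<close>. The squares on the
      right are the two losses.\<close>
    have "2 * a\<^sup>2 + 4 * x\<^sup>2 + 4 * y\<^sup>2 - (a - x + y)\<^sup>2 = (a - (y - x))\<^sup>2 + 2 * (y + x)\<^sup>2"
      by (simp add: power2_eq_square algebra_simps)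
    then show ?thesis using zero_le_power2[of "a - (y - x)"] zero_le_power2[of "y + x"] by linarith
  qed
  have ps: "AE \<omega> in M. path_integral (-\<tau>) (t - \<tau>) \<omega> = path_integral (-\<tau>) (s - \<tau>) \<omega> + ?A \<omega>"
    using assms by (intro path_integral_split) auto
  have "0 \<le> t" using assms by simp
  have ae: "AE \<omega> in M. (W t \<omega>)\<^sup>2 \<le> 2 * (W s \<omega>)\<^sup>2 + 4 * (?A \<omega>)\<^sup>2 + 4 * \<sigma>\<^sup>2 * (?N \<omega>)\<^sup>2"
    using W_eq[OF assms(1)] W_eq[OF \<open>0 \<le> t\<close>] ps
  proof eventually_elim
    case (elim \<omega>)
    then have "W t \<omega> = W s \<omega> - ?A \<omega> + \<sigma> * ?N \<omega>" by (simp add: algebra_simps)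
    then show ?case
      using sq[of "W s \<omega>" "?A \<omega>" "\<sigma> * ?N \<omega>"] by (simp add: power_mult_distrib)
  qed
  note i = square_integrableD[OF W_square_integrable] square_integrableD[OF path_integral_square(1)[OF le]]
    square_integrableD[OF stochastic_integral_square_integrable(2)[OF N]]
  have "second_moment t \<le> (\<integral>\<omega>. 2 * (W s \<omega>)\<^sup>2 + 4 * (?A \<omega>)\<^sup>2 + 4 * \<sigma>\<^sup>2 * (?N \<omega>)\<^sup>2 \<partial>M)"
    unfolding second_moment_def by (rule integral_mono_AE[OF _ _ ae]) (use i in simp_all)
  also have "\<dots> = 2 * second_moment s + 4 * (\<integral>\<omega>. (?A \<omega>)\<^sup>2 \<partial>M) + 4 * \<sigma>\<^sup>2 * (\<integral>\<omega>. (?N \<omega>)\<^sup>2 \<partial>M)"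
    unfolding second_moment_def using i by simp
  also have "\<dots> \<le> 2 * second_moment s + 4 * ((t - s) * energy (s - \<tau>) (t - \<tau>)) + 4 * \<sigma>\<^sup>2 * energy (s - \<tau>) (t - \<tau>)"
    using path_integral_square(2)[OF le] integral_shifted_square[OF N] by simp
  finally show ?thesis by (simp add: algebra_simps)
qed

text \<open>Averaging over the starting time \<open>s\<close> turns the value at \<open>s\<close>
  into energy. The constant is 2 from that average plus \<open>4 + 4 * \<sigma>^2\<close> from the
  increment, as \<open>t - s\<close> is at most 1. The window reaches back \<open>1 + \<tau>\<close>
  to contain the delayed windows as well, and \<open>1 \<le> t\<close> keeps all starting times
  nonnegative.\<close>

lemma second_moment_le_energy:
  assumes "1 \<le> t"
  shows "second_moment t \<le> (6 + 4 * \<sigma>\<^sup>2) * energy (t - 1 - \<tau>) t"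
proof -
  let ?i = "indicator {t - 1<..t} :: real \<Rightarrow> real" and ?E = "energy (t - 1 - \<tau>) t"
  have 1: "integrable lborel ?i" "(\<integral>s. ?i s \<partial>lborel) = 1" by auto
  have "second_moment t = (\<integral>s. ?i s * second_moment t \<partial>lborel)" using 1 by simp
  also have "\<dots> \<le> (\<integral>s. 2 * (?i s * second_moment s) + ?i s * ((4 + 4 * \<sigma>\<^sup>2) * ?E) \<partial>lborel)"
  proof (rule integral_mono)
    show "integrable lborel (\<lambda>s. ?i s * second_moment t)" using 1 by simp
    show "integrable lborel (\<lambda>s. 2 * (?i s * second_moment s) + ?i s * ((4 + 4 * \<sigma>\<^sup>2) * ?E))"
      using 1 second_moment_integrable by simp
    fix s
    show "?i s * second_moment t \<le> 2 * (?i s * second_moment s) + ?i s * ((4 + 4 * \<sigma>\<^sup>2) * ?E)"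
    proof (cases "s \<in> {t - 1<..t}")
      case True
      then have "second_moment t \<le> 2 * second_moment s + (4 * (t - s) + 4 * \<sigma>\<^sup>2) * energy (s - \<tau>) (t - \<tau>)"
        using assms by (intro second_moment_increment) auto
      also have "(4 * (t - s) + 4 * \<sigma>\<^sup>2) * energy (s - \<tau>) (t - \<tau>) \<le> (4 + 4 * \<sigma>\<^sup>2) * ?E"
        using True \<tau>_pos by (intro mult_mono energy_mono energy_nonneg) auto
      finally show ?thesis using True by simp
    qed simp
  qed
  also have "\<dots> = 2 * energy (t - 1) t + (4 + 4 * \<sigma>\<^sup>2) * ?E"
    unfolding energy_def[of "t - 1" t] using 1 second_moment_integrable[of "t - 1" t] by simp
  also have "energy (t - 1) t \<le> ?E" using \<tau>_pos by (intro energy_mono) auto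
  finally show ?thesis by (simp add: algebra_simps)
qed

text \<open>Being increasing and bounded, \<open>energy 0 t\<close> converges. The energy of a
  window of fixed length \<open>1 + \<tau>\<close> is a difference of two of its values and so tends
  to zero.\<close>

lemma second_moment_tendsto_0:
  assumes small: "2 * \<tau> + \<sigma>\<^sup>2 < 2"
  shows "(second_moment \<longlongrightarrow> 0) at_top"
proof -
  obtain C where C: "\<And>t. 0 \<le> t \<Longrightarrow> energy 0 t \<le> C"
    by (rule energy_bounded[OF small]) blast
  define L where "L = (SUP t\<in>{0..}. energy 0 t)"
  have bdd: "bdd_above (energy 0 ` {0..})" using C by (auto intro!: bdd_aboveI)
  have upper: "energy 0 t \<le> L" if "0 \<le> t" for t
    unfolding L_def using bdd that by (intro cSUP_upper) auto
  have lim: "((\<lambda>t. energy 0 t) \<longlongrightarrow> L) at_top"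
  proof (rule order_tendstoI)
    fix a assume "a < L"
    then obtain t0 where t0: "0 \<le> t0" "a < energy 0 t0"
      unfolding L_def using less_cSUP_iff[OF _ bdd] by auto
    show "\<forall>\<^sub>F t in at_top. a < energy 0 t"
      using eventually_ge_at_top[of t0]
      by eventually_elim (use t0 energy_mono[of 0 0 t0] in force)
  next
    fix a assume "L < a"
    show "\<forall>\<^sub>F t in at_top. energy 0 t < a"
      using eventually_ge_at_top[of 0] by eventually_elim (use upper \<open>L < a\<close> in force)
  qed
  have "LIM t at_top. - (1 + \<tau>) + t :> at_top"
    by (rule filterlim_tendsto_add_at_top[OF tendsto_const filterlim_ident])
  then have "LIM t at_top. t - (1 + \<tau>) :> at_top"
    by (simp only: uminus_add_conv_diff)
  from filterlim_compose[OF lim this]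
  have lim': "((\<lambda>t. energy 0 (t - (1 + \<tau>))) \<longlongrightarrow> L) at_top" .
  have "((\<lambda>t. (6 + 4 * \<sigma>\<^sup>2) * (energy 0 t - energy 0 (t - (1 + \<tau>)))) \<longlongrightarrow> (6 + 4 * \<sigma>\<^sup>2) * (L - L)) at_top"
    by (intro tendsto_intros lim lim')
  then have "((\<lambda>t. (6 + 4 * \<sigma>\<^sup>2) * (energy 0 t - energy 0 (t - (1 + \<tau>)))) \<longlongrightarrow> 0) at_top" by simp
  moreover have "\<forall>\<^sub>F t in at_top. norm (second_moment t) \<le> (6 + 4 * \<sigma>\<^sup>2) * (energy 0 t - energy 0 (t - (1 + \<tau>)))"
    using eventually_ge_at_top[of "1 + \<tau>"]
  proof eventually_elim
    case (elim t)
    then have "energy 0 t = energy 0 (t - (1 + \<tau>)) + energy (t - (1 + \<tau>)) t"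
      using \<tau>_pos by (intro energy_split) auto
    then show ?case using second_moment_le_energy[of t] elim \<tau>_pos second_moment_nonneg[of t] by (simp add: diff_diff_eq)
  qed
  ultimately show ?thesis by (rule Lim_null_comparison[rotated])
qed

text \<open>With the nonnegative integral the limit 0 cannot stem from the default value of a
  Bochner integral; the transfer relies on square integrability at each fixed time.\<close>

lemma nn_second_moment_tendsto_0:
  assumes "2 * \<tau> + \<sigma>\<^sup>2 < 2"
  shows "((\<lambda>t. \<integral>\<^sup>+\<omega>. ennreal ((w t \<omega>)\<^sup>2) \<partial>M) \<longlongrightarrow> 0) at_top"
proof -
  have "((\<lambda>t. ennreal (second_moment t)) \<longlongrightarrow> ennreal 0) at_top"
    by (intro tendsto_ennrealI second_moment_tendsto_0 assms)
  moreover have "\<forall>\<^sub>F t in at_top. ennreal (second_moment t) = (\<integral>\<^sup>+\<omega>. ennreal ((w t \<omega>)\<^sup>2) \<partial>M)"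
    using eventually_ge_at_top[of "-\<tau>"]
  proof eventually_elim
    case (elim t)
    have "ennreal (second_moment t) = (\<integral>\<^sup>+\<omega>. ennreal ((W t \<omega>)\<^sup>2) \<partial>M)"
      unfolding second_moment_def
      by (rule nn_integral_eq_integral[symmetric]) (simp_all add: square_integrableD W_square_integrable)
    with elim show ?case by (simp add: W_def)
  qed
  ultimately show ?thesis by (simp add: tendsto_cong)
qed

end

section \<open>The stability condition\<close>

text \<open>Put x = 1 - \<tau> and y = 1 - \<sigma>^2 / 2. Both conditions say that x and y are
  positive and x^2 + y^2 > 1: the first has the form 1 - y^2 < x^2, the second 1 - x^2 <
  y^2.\<close>

lemma stability_condition_equiv:
  fixes \<tau> \<sigma> :: real
  assumes "0 < \<tau>" "0 \<le> \<sigma>"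
  shows "\<sigma>\<^sup>2 < 2 \<and> \<tau> < 1 - sqrt (\<sigma>\<^sup>2 - \<sigma>^4 / 4) \<longleftrightarrow> \<tau> < 1 \<and> \<sigma> < sqrt (2 - \<tau>) - sqrt \<tau>"
proof -
  have one: "\<sigma>\<^sup>2 - \<sigma>^4 / 4 = 1 - (1 - \<sigma>\<^sup>2 / 2)\<^sup>2"
    by (simp add: power2_eq_square power4_eq_xxxx algebra_simps)
  have two: "\<tau> * (2 - \<tau>) = 1 - (1 - \<tau>)\<^sup>2" by (simp add: power2_eq_square algebra_simps)
  have A: "\<sigma>\<^sup>2 < 2 \<and> \<tau> < 1 - sqrt (\<sigma>\<^sup>2 - \<sigma>^4 / 4) \<longleftrightarrow>
      \<sigma>\<^sup>2 < 2 \<and> \<tau> < 1 \<and> \<sigma>\<^sup>2 - \<sigma>^4 / 4 < (1 - \<tau>)\<^sup>2"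
  proof (cases "\<sigma>\<^sup>2 < 2")
    case True
    \<comment> \<open>\<open>sqrt\<close> is negative on negative numbers, so
      \<open>\<tau> < 1\<close> can be inferred only after the radicand is seen to be
      nonnegative.\<close>
    then have "(1 - \<sigma>\<^sup>2 / 2)\<^sup>2 \<le> 1" by (intro power_le_one) simp_all
    then have nn: "0 \<le> sqrt (\<sigma>\<^sup>2 - \<sigma>^4 / 4)" unfolding one by simp
    have "\<tau> < 1 - sqrt (\<sigma>\<^sup>2 - \<sigma>^4 / 4) \<longleftrightarrow> \<tau> < 1 \<and> sqrt (\<sigma>\<^sup>2 - \<sigma>^4 / 4) < 1 - \<tau>"
      using nn by linarith
    also have "\<dots> \<longleftrightarrow> \<tau> < 1 \<and> \<sigma>\<^sup>2 - \<sigma>^4 / 4 < (1 - \<tau>)\<^sup>2"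
      using real_sqrt_less_iff[of "\<sigma>\<^sup>2 - \<sigma>^4 / 4" "(1 - \<tau>)\<^sup>2"] by auto
    finally show ?thesis using True by simp
  qed simp
  have B: "\<sigma> < sqrt (2 - \<tau>) - sqrt \<tau> \<longleftrightarrow> \<sigma>\<^sup>2 < 2 \<and> \<sigma>\<^sup>2 - \<sigma>^4 / 4 < (1 - \<tau>)\<^sup>2" if "\<tau> < 1"
  proof -
    have "sqrt \<tau> < sqrt (2 - \<tau>)" using that by simp
    then have "\<sigma> < sqrt (2 - \<tau>) - sqrt \<tau> \<longleftrightarrow> \<sigma>\<^sup>2 < (sqrt (2 - \<tau>) - sqrt \<tau>)\<^sup>2"
      using power_strict_mono[of \<sigma> _ 2] power2_less_imp_less assms(2) by (metis diff_ge_0_iff_ge less_imp_le zero_less_numeral)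
    also have "(sqrt (2 - \<tau>) - sqrt \<tau>)\<^sup>2 = 2 - 2 * sqrt (\<tau> * (2 - \<tau>))"
      using assms that by (simp add: power2_diff real_sqrt_mult)
    also have "\<sigma>\<^sup>2 < 2 - 2 * sqrt (\<tau> * (2 - \<tau>)) \<longleftrightarrow> sqrt (\<tau> * (2 - \<tau>)) < 1 - \<sigma>\<^sup>2 / 2" by auto
    also have "\<dots> \<longleftrightarrow> \<sigma>\<^sup>2 < 2 \<and> \<tau> * (2 - \<tau>) < (1 - \<sigma>\<^sup>2 / 2)\<^sup>2"
    proof (cases "\<sigma>\<^sup>2 < 2")
      case True
      then show ?thesis using real_sqrt_less_iff[of "\<tau> * (2 - \<tau>)" "(1 - \<sigma>\<^sup>2 / 2)\<^sup>2"] by auto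
    next
      case False
      have "0 \<le> sqrt (\<tau> * (2 - \<tau>))" using assms that by simp
      moreover have "1 - \<sigma>\<^sup>2 / 2 \<le> 0" using False by simp
      ultimately show ?thesis using False by linarith
    qed
    finally show ?thesis unfolding one two by auto
  qed
  show ?thesis using A B by blast
qed

text \<open>After squaring, \<sigma>^2 is below 2 minus twice the geometric mean of \<tau> and 2 -
  \<tau>, and that mean is at least the smaller number, which is \<tau>.\<close>

lemma stability_condition_small:
  fixes \<tau> \<sigma> :: real
  assumes "0 < \<tau>" "0 \<le> \<sigma>" "\<tau> < 1" "\<sigma> < sqrt (2 - \<tau>) - sqrt \<tau>"
  shows "2 * \<tau> + \<sigma>\<^sup>2 < 2"
proof -
  have "\<sigma>\<^sup>2 < (sqrt (2 - \<tau>) - sqrt \<tau>)\<^sup>2"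
    using assms by (intro power_strict_mono) auto
  also have "\<dots> = 2 - 2 * (sqrt \<tau> * sqrt (2 - \<tau>))"
    using assms by (simp add: power2_diff)
  also have "\<tau> = sqrt \<tau> * sqrt \<tau>" using assms by simp
  then have "2 - 2 * (sqrt \<tau> * sqrt (2 - \<tau>)) \<le> 2 - 2 * \<tau>"
    using assms mult_left_mono[of "sqrt \<tau>" "sqrt (2 - \<tau>)" "sqrt \<tau>"] by simp
  finally show ?thesis by simp
qed

theorem theorem1:
  fixes M :: "'a measure" and F :: "real \<Rightarrow> 'a measure" and B :: "real \<Rightarrow> 'a \<Rightarrow> real"
    and \<tau> \<sigma> :: real
  assumes "standard_brownian_motion M F B"
    and "\<tau> > 0" and "\<sigma> \<ge> 0"
  shows "((\<sigma>\<^sup>2 < 2 \<and> \<tau> < 1 - sqrt (\<sigma>\<^sup>2 - \<sigma>^4 / 4)) \<longleftrightarrow>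
          (\<tau> < 1 \<and> \<sigma> < sqrt (2 - \<tau>) - sqrt \<tau>)) \<and>
         (\<sigma>\<^sup>2 < 2 \<and> \<tau> < 1 - sqrt (\<sigma>\<^sup>2 - \<sigma>^4 / 4) \<longrightarrow>
           (\<forall>w0 w. continuous_on {-\<tau>..0} w0 \<longrightarrow> sdde_solution M F B \<tau> \<sigma> w0 w \<longrightarrow>
              ((\<lambda>t. \<integral>\<^sup>+\<omega>. ennreal ((w t \<omega>)\<^sup>2) \<partial>M) \<longlongrightarrow> 0) at_top))"
proof (intro conjI impI allI)
  show equiv: "(\<sigma>\<^sup>2 < 2 \<and> \<tau> < 1 - sqrt (\<sigma>\<^sup>2 - \<sigma>^4 / 4)) \<longleftrightarrow> (\<tau> < 1 \<and> \<sigma> < sqrt (2 - \<tau>) - sqrt \<tau>)"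
    by (rule stability_condition_equiv[OF assms(2,3)])
  fix w0 w
  assume "\<sigma>\<^sup>2 < 2 \<and> \<tau> < 1 - sqrt (\<sigma>\<^sup>2 - \<sigma>^4 / 4)" and sol: "sdde_solution M F B \<tau> \<sigma> w0 w"
  then have small: "2 * \<tau> + \<sigma>\<^sup>2 < 2"
    using stability_condition_small[OF assms(2,3)] equiv by blast
  interpret delay_equation M F B \<tau> \<sigma> w0 w
    using assms(1,2) sol by (simp add: delay_equation_def delay_equation_axioms_def)
  show "((\<lambda>t. \<integral>\<^sup>+\<omega>. ennreal ((w t \<omega>)\<^sup>2) \<partial>M) \<longlongrightarrow> 0) at_top"
    by (rule nn_second_moment_tendsto_0[OF small])
qed

end
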